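(* Let $W=\{W(t):t\in[a,b]\}$ be a standard Brownian motion and let $L$ be the weak random operator $\langle Lf,h\rangle:=\varepsilon(f,h)=-\int_a^b \frac{f'(t)h'(t)}{2}\,dt-\int_a^b\frac{f'(t)h(t)}{2}\,dW(t)$. Two linearly independent solutions of the problem $Lf=0$ are the following integrals of geometric Brownian motion: $$u(t):=\frac{\int_a^t e^{W(s)-\frac{s}{2}}\,ds}{\int_a^b e^{W(s)-\frac{s}{2}}\,ds},\qquad v(t):=\frac{\int_t^b e^{W(s)-\frac{s}{2}}\,ds}{\int_a^b e^{W(s)-\frac{s}{2}}\,ds},\qquad t\in[a,b].$$ Furthermore, they satisfy $u(a)=0$, $u(b)=1$, $v(a)=1$ and $v(b)=0$.
   Context: Fix real numbers $a<b$ and a standard Brownian motion $W=\{W(t):t\in[a,b]\}$ with continuous paths. Let $H_1$ be the Sobolev space of absolutely continuous functions $h:[a,b]\to\mathbb{R}$ with $h,h'\in L_2[a,b]$ and $h(a)=h(b)=0$. The operator $L$ is formally $(Lf)(t)=\frac{f''(t)}{2}-\frac{W'(t)f'(t)}{2}$; it is given rigorous meaning only through the bilinear form $$\langle Lf,h\rangle:=\varepsilon(f,h):=-\int_a^b\frac{f'(t)h'(t)}{2}\,dt-\int_a^b\frac{f'(t)h(t)}{2}\,dW(t).$$ The form is defined for $f,h\in H_1$; the same formula is used when $f$ is replaced by an absolutely continuous process (no boundary conditions imposed) and $h\in H_1$. Convention on $dW$-integrals: they are Itô integrals when the integrand is adapted, and random constant factors (even non-adapted ones) are taken out of the integral, i.e.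 $\int_a^b \beta\,Y(t)\,dW(t):=\beta\int_a^b Y(t)\,dW(t)$ for a random variable $\beta$ and an adapted integrand $Y$. A stochastic process $\{u(t):t\in[a,b]\}$ is called a solution of $Lf=0$ if for all $h\in H_1$, $\varepsilon(u,h)=0$ almost surely. *)

theory Defs
  imports "HOL-Probability.Probability"
begin

section \<open>Brownian motion on a compact interval\<close>

text \<open>
  The interval need not contain \<open>0\<close>, so no normalisation of the starting value \<open>W a\<close> is
  imposed: it may be \<open>0\<close>, it may be the value at time \<open>a\<close> of a Brownian motion started at an
  earlier time, or (for \<open>a < 0\<close>) that of a two-sided Brownian motion vanishing at \<open>0\<close>.
\<close>

definition standard_brownian_motion ::
    "'w measure \<Rightarrow> real \<Rightarrow> real \<Rightarrow> (real \<Rightarrow> 'w \<Rightarrow> real) \<Rightarrow> bool" where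
  "standard_brownian_motion M a b W \<longleftrightarrow>
     prob_space M \<and>
     (\<forall>t\<in>{a..b}. W t \<in> borel_measurable M) \<and>
     (\<forall>\<omega>\<in>space M. continuous_on {a..b} (\<lambda>t. W t \<omega>)) \<and>
     (\<forall>s t. a \<le> s \<longrightarrow> s < t \<longrightarrow> t \<le> b \<longrightarrow>
        distributed M lborel (\<lambda>\<omega>. W t \<omega> - W s \<omega>) (normal_density 0 (sqrt (t - s)))) \<and>
     (\<forall>(n::nat) \<tau>. (\<forall>i\<le>n. \<tau> i \<in> {a..b}) \<longrightarrow> (\<forall>i<n. \<tau> i \<le> \<tau> (Suc i)) \<longrightarrow>
        prob_space.indep_vars M (\<lambda>_. borel) (\<lambda>i \<omega>. W (\<tau> (Suc i)) \<omega> - W (\<tau> i) \<omega>) {..<n})"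

text \<open>
  The filtration is generated by the increments after time \<open>a\<close>.  It is the natural filtration
  of \<open>W\<close> if \<open>W a = 0\<close>; in general the increments after time \<open>t\<close> are independent of it,
  whatever the joint law of \<open>W a\<close> and the increments.
\<close>

definition increment_filtration ::
    "'w measure \<Rightarrow> real \<Rightarrow> (real \<Rightarrow> 'w \<Rightarrow> real) \<Rightarrow> real \<Rightarrow> 'w measure" where
  "increment_filtration M a W t =
     sigma (space M)
       {(\<lambda>\<omega>. W s \<omega> - W a \<omega>) -` B \<inter> space M | s B. s \<in> {a..t} \<and> B \<in> sets borel}"


section \<open>Ito integral\<close>

definition simple_adapted ::
    "'w measure \<Rightarrow> real \<Rightarrow> real \<Rightarrow> (real \<Rightarrow> 'w \<Rightarrow> real) \<Rightarrow>
     nat \<Rightarrow> (nat \<Rightarrow> real) \<Rightarrow> (nat \<Rightarrow> 'w \<Rightarrow> real) \<Rightarrow> bool" where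
  "simple_adapted M a b W n \<tau> \<xi> \<longleftrightarrow>
     \<tau> 0 = a \<and> \<tau> n = b \<and> (\<forall>i<n. \<tau> i \<le> \<tau> (Suc i)) \<and>
     (\<forall>i<n. \<xi> i \<in> borel_measurable (increment_filtration M a W (\<tau> i)))"

definition simple_process ::
    "nat \<Rightarrow> (nat \<Rightarrow> real) \<Rightarrow> (nat \<Rightarrow> 'w \<Rightarrow> real) \<Rightarrow> real \<Rightarrow> 'w \<Rightarrow> real" where
  "simple_process n \<tau> \<xi> t \<omega> = (\<Sum>i<n. \<xi> i \<omega> * indicator {\<tau> i<..\<tau> (Suc i)} t)"

definition simple_integral ::
    "(real \<Rightarrow> 'w \<Rightarrow> real) \<Rightarrow> nat \<Rightarrow> (nat \<Rightarrow> real) \<Rightarrow> (nat \<Rightarrow> 'w \<Rightarrow> real) \<Rightarrow> 'w \<Rightarrow> real" where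
  "simple_integral W n \<tau> \<xi> \<omega> = (\<Sum>i<n. \<xi> i \<omega> * (W (\<tau> (Suc i)) \<omega> - W (\<tau> i) \<omega>))"

text \<open>
  \<open>I\<close> is (a version of) the Ito integral over \<open>[a,b]\<close> of the adapted process \<open>Y\<close>, for
  measurable adapted integrands with almost surely square integrable paths: simple adapted
  processes approximate \<open>Y\<close> in \<open>L\<^sub>2[a,b]\<close> in probability, and their integrals converge to \<open>I\<close>
  in probability.  Such an \<open>I\<close> is unique up to almost sure equality.  The measurability
  conditions make the events below measurable, and the nonnegative integral takes the value
  \<open>\<infinity>\<close> (not \<open>0\<close>) when a path is not square integrable.
\<close>

definition has_ito_integral ::
    "'w measure \<Rightarrow> real \<Rightarrow> real \<Rightarrow> (real \<Rightarrow> 'w \<Rightarrow> real) \<Rightarrow>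
     (real \<Rightarrow> 'w \<Rightarrow> real) \<Rightarrow> ('w \<Rightarrow> real) \<Rightarrow> bool" where
  "has_ito_integral M a b W Y I \<longleftrightarrow>
     (\<lambda>(t, \<omega>). Y t \<omega>) \<in> borel_measurable (restrict_space lborel {a..b} \<Otimes>\<^sub>M M) \<and>
     (\<forall>t\<in>{a..b}. Y t \<in> borel_measurable (increment_filtration M a W t)) \<and>
     (AE \<omega> in M. (\<integral>\<^sup>+ t\<in>{a..b}. ennreal ((Y t \<omega>)\<^sup>2) \<partial>lborel) < \<infinity>) \<and>
     I \<in> borel_measurable M \<and>
     (\<exists>n \<tau> \<xi>.
        (\<forall>k. simple_adapted M a b W (n k) (\<tau> k) (\<xi> k)) \<and>
        (\<forall>e>0. (\<lambda>k::nat. measure M {\<omega>\<in>space M.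
            (\<integral>\<^sup>+ t\<in>{a..b}. ennreal ((simple_process (n k) (\<tau> k) (\<xi> k) t \<omega> - Y t \<omega>)\<^sup>2) \<partial>lborel)
              > ennreal e}) \<longlonglongrightarrow> 0) \<and>
        (\<forall>e>0. (\<lambda>k::nat. measure M {\<omega>\<in>space M.
            \<bar>simple_integral W (n k) (\<tau> k) (\<xi> k) \<omega> - I \<omega>\<bar> > e}) \<longlonglongrightarrow> 0))"

text \<open>
  The convention that a random factor \<open>\<beta>\<close>, adapted or not, is taken out of the integral.
  The integrand \<open>Z\<close> only matters for almost every \<open>t\<close>, as it will involve the almost
  everywhere derivative of an absolutely continuous function.  The case \<open>\<beta> = 1\<close> is the
  Ito integral itself.
\<close>

definition has_dW_integral ::
    "'w measure \<Rightarrow> real \<Rightarrow> real \<Rightarrow> (real \<Rightarrow> 'w \<Rightarrow> real) \<Rightarrow>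
     (real \<Rightarrow> 'w \<Rightarrow> real) \<Rightarrow> ('w \<Rightarrow> real) \<Rightarrow> bool" where
  "has_dW_integral M a b W Z J \<longleftrightarrow>
     (\<exists>\<beta> Y I.
        \<beta> \<in> borel_measurable M \<and>
        has_ito_integral M a b W Y I \<and>
        (AE \<omega> in M. AE t in lborel. t \<in> {a..b} \<longrightarrow> Z t \<omega> = \<beta> \<omega> * Y t \<omega>) \<and>
        (AE \<omega> in M. J \<omega> = \<beta> \<omega> * I \<omega>))"


section \<open>Absolutely continuous functions and the space \<open>H\<^sub>1\<close>\<close>

definition abs_continuous_on :: "real \<Rightarrow> real \<Rightarrow> (real \<Rightarrow> real) \<Rightarrow> bool" where
  "abs_continuous_on a b f \<longleftrightarrow>
     (\<forall>e>0. \<exists>d>0. \<forall>(n::nat) x y.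
        (\<forall>i<n. a \<le> x i \<and> x i \<le> y i \<and> y i \<le> b) \<longrightarrow>
        disjoint_family_on (\<lambda>i. {x i<..<y i}) {..<n} \<longrightarrow>
        (\<Sum>i<n. y i - x i) < d \<longrightarrow>
        (\<Sum>i<n. \<bar>f (y i) - f (x i)\<bar>) < e)"

definition L2_on :: "real \<Rightarrow> real \<Rightarrow> (real \<Rightarrow> real) \<Rightarrow> bool" where
  "L2_on a b g \<longleftrightarrow>
     set_borel_measurable lborel {a..b} g \<and> set_integrable lborel {a..b} (\<lambda>t. (g t)\<^sup>2)"

text \<open>
  The existence almost everywhere of the derivative follows from absolute continuity; it is
  listed because \<open>deriv h t\<close> has an unspecified value where \<open>h\<close> is not differentiable.
\<close>

definition H1 :: "real \<Rightarrow> real \<Rightarrow> (real \<Rightarrow> real) set" where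
  "H1 a b = {h. abs_continuous_on a b h \<and>
     (AE t in lborel. t \<in> {a..b} \<longrightarrow> h differentiable (at t)) \<and>
     L2_on a b h \<and> L2_on a b (deriv h) \<and> h a = 0 \<and> h b = 0}"


section \<open>The bilinear form and the equation \<open>L f = 0\<close>\<close>

text \<open>
  \<open>has_form_value M a b W f h X\<close> says that \<open>\<epsilon>(f,h)\<close> is well defined and that the random
  variable \<open>X\<close> is a version of it.  Being given by a stochastic integral, \<open>\<epsilon>(f,h)\<close> is
  determined only up to almost sure equality.
\<close>

definition has_form_value ::
    "'w measure \<Rightarrow> real \<Rightarrow> real \<Rightarrow> (real \<Rightarrow> 'w \<Rightarrow> real) \<Rightarrow>
     (real \<Rightarrow> 'w \<Rightarrow> real) \<Rightarrow> (real \<Rightarrow> real) \<Rightarrow> ('w \<Rightarrow> real) \<Rightarrow> bool" where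
  "has_form_value M a b W f h X \<longleftrightarrow>
     X \<in> borel_measurable M \<and>
     (AE \<omega> in M. set_integrable lborel {a..b} (\<lambda>t. deriv (\<lambda>s. f s \<omega>) t * deriv h t / 2)) \<and>
     (\<exists>J. has_dW_integral M a b W (\<lambda>t \<omega>. deriv (\<lambda>s. f s \<omega>) t * h t / 2) J \<and>
        (AE \<omega> in M.
           X \<omega> = - (LINT t:{a..b}|lborel. deriv (\<lambda>s. f s \<omega>) t * deriv h t / 2) - J \<omega>))"

definition is_solution ::
    "'w measure \<Rightarrow> real \<Rightarrow> real \<Rightarrow> (real \<Rightarrow> 'w \<Rightarrow> real) \<Rightarrow> (real \<Rightarrow> 'w \<Rightarrow> real) \<Rightarrow> bool" where
  "is_solution M a b W f \<longleftrightarrow>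
     (\<forall>t\<in>{a..b}. f t \<in> borel_measurable M) \<and>
     (AE \<omega> in M. abs_continuous_on a b (\<lambda>t. f t \<omega>)) \<and>
     (\<forall>h\<in>H1 a b. \<exists>X. has_form_value M a b W f h X \<and> (AE \<omega> in M. X \<omega> = 0))"

text \<open>
  As random factors act as constants here, the coefficients are allowed to be random
  variables; deterministic coefficients are a special case.
\<close>

definition linearly_independent_processes ::
    "'w measure \<Rightarrow> real \<Rightarrow> real \<Rightarrow> (real \<Rightarrow> 'w \<Rightarrow> real) \<Rightarrow> (real \<Rightarrow> 'w \<Rightarrow> real) \<Rightarrow> bool" where
  "linearly_independent_processes M a b f g \<longleftrightarrow>
     (\<forall>C\<in>borel_measurable M. \<forall>D\<in>borel_measurable M.
        (\<forall>t\<in>{a..b}. AE \<omega> in M. C \<omega> * f t \<omega> + D \<omega> * g t \<omega> = 0) \<longrightarrow>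
        (AE \<omega> in M. C \<omega> = 0) \<and> (AE \<omega> in M. D \<omega> = 0))"

end

theory Submission
  imports Defs
begin

text \<open>
  With \<open>G(t) = exp (W(t) - W(a) - (t - a)/2)\<close> the factor \<open>exp (W(a) - a/2)\<close> cancels in both
  quotients, so \<open>u\<close> and \<open>v\<close> are of the form \<open>c \<integral>\<^sub>a\<^sup>t G ds + d\<close> with random \<open>c\<close> and \<open>d\<close>, and
  \<open>c\<close> may be taken out of the stochastic integral. Since \<open>dG = G dW\<close> and \<open>h\<close> vanishes at both ends,
  the claim reduces to the integration by parts formula
  \<open>\<integral> G h dW = - \<integral> G h' dt\<close>. On a uniform grid, summation by parts turns the Riemann sum of the
  left side into \<open>- \<Sum> \<Delta>h\<^sub>i G\<^sub>i\<^sub>+\<^sub>1\<close>, which converges pathwise because \<open>h\<close> is the integral of its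
  derivative, minus \<open>\<Sum> h\<^sub>i (\<Delta>G\<^sub>i - G\<^sub>i \<Delta>W\<^sub>i)\<close>. The latter is a sum of martingale differences,
  whose second moment is of order \<open>n \<delta>\<^sup>2 = (b - a)\<^sup>2/n\<close>, so it vanishes in probability.
\<close>

section \<open>Absolutely continuous functions\<close>

text \<open>The factor \<open>c\<close>, which is \<open>1 / gbm_int b\<close> for \<open>u\<close>,
  depends on the whole path, so \<open>u\<close> is not adapted; the form makes sense because
  \<open>c\<close> multiplies an adapted integrand, and only the integrand \<open>G h\<close> has to
  be treated. The equation \<open>dG = G dW\<close> enters as a one-step Euler error instead of
  through Ito's formula. Over a step of length \<delta> with Brownian increment X its size relative
  to G is R = exp(X - \<delta>/2) - 1 - X. The shift by \<delta>/2 gives the exponential mean 1, so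
  R has mean 0, and E R^2 = exp(\<delta>) - 1 - \<delta> is at most \<delta>^2 for small \<delta>.
  The weight G_i has second moment exp(i \<delta>), at most exp(b - a). Orthogonality of the terms
  is essential: the triangle inequality alone would bound the L2 norm of the sum only by a multiple
  of n \<delta> = b - a, which does not shrink. A second obstacle is that \<open>h\<close> has a
  derivative only almost everywhere; passing from its increments to integrals of
  \<open>deriv h\<close> needs the fundamental theorem for absolutely continuous functions.\<close>

lemma abs_continuous_onE:
  assumes "abs_continuous_on a b h" "e > 0"
  obtains d where "d > 0"
    "\<forall>(n::nat) l r. (\<forall>i<n. a \<le> l i \<and> l i \<le> r i \<and> r i \<le> b) \<longrightarrow>
        disjoint_family_on (\<lambda>i. {l i<..<r i}) {..<n} \<longrightarrow> (\<Sum>i<n. r i - l i) < d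
      \<longrightarrow> (\<Sum>i<n. \<bar>h (r i) - h (l i)\<bar>) < e"
  using assms(1)[unfolded abs_continuous_on_def, THEN spec, THEN mp, OF assms(2)] that
  by (elim exE conjE)

lemma abs_continuous_onI:
  assumes "\<And>e. e > 0 \<Longrightarrow> \<exists>d>0. \<forall>(n::nat) l r.
        (\<forall>i<n. a \<le> l i \<and> l i \<le> r i \<and> r i \<le> b) \<longrightarrow>
        disjoint_family_on (\<lambda>i. {l i<..<r i}) {..<n} \<longrightarrow>
        (\<Sum>i<n. r i - l i) < d \<longrightarrow> (\<Sum>i<n. \<bar>h (r i) - h (l i)\<bar>) < e"
  shows "abs_continuous_on a b h"
  unfolding abs_continuous_on_def by (intro allI impI assms)

lemma abs_continuous_on_subinterval:
  assumes "abs_continuous_on a b h" "a \<le> x" "y \<le> b"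
  shows "abs_continuous_on x y h"
proof (rule abs_continuous_onI)
  fix e :: real assume "e > 0"
  obtain d where "d > 0" and d: "\<forall>(n::nat) l r. (\<forall>i<n. a \<le> l i \<and> l i \<le> r i \<and> r i \<le> b) \<longrightarrow>
        disjoint_family_on (\<lambda>i. {l i<..<r i}) {..<n} \<longrightarrow> (\<Sum>i<n. r i - l i) < d
      \<longrightarrow> (\<Sum>i<n. \<bar>h (r i) - h (l i)\<bar>) < e"
    by (rule abs_continuous_onE[OF assms(1) \<open>e > 0\<close>])
  show "\<exists>d>0. \<forall>(n::nat) l r. (\<forall>i<n. x \<le> l i \<and> l i \<le> r i \<and> r i \<le> y) \<longrightarrow>
           disjoint_family_on (\<lambda>i. {l i<..<r i}) {..<n} \<longrightarrow>
           (\<Sum>i<n. r i - l i) < d \<longrightarrow> (\<Sum>i<n. \<bar>h (r i) - h (l i)\<bar>) < e"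
  proof (intro exI conjI allI impI)
    show "d > 0" by fact
  next
    fix n :: nat and l r
    assume "\<forall>i<n. x \<le> l i \<and> l i \<le> r i \<and> r i \<le> y"
      "disjoint_family_on (\<lambda>i. {l i<..<r i}) {..<n}" "(\<Sum>i<n. r i - l i) < d"
    then show "(\<Sum>i<n. \<bar>h (r i) - h (l i)\<bar>) < e"
      using assms(2,3) by (intro d[rule_format]) auto
  qed
qed

lemma abs_continuous_on_imp_continuous_on:
  assumes "abs_continuous_on a b h"
  shows "continuous_on {a..b} h"
  unfolding continuous_on_iff
proof (intro ballI allI impI)
  fix x e :: real assume x: "x \<in> {a..b}" and "e > 0"
  obtain d where "d > 0" and d: "\<forall>(n::nat) l r. (\<forall>i<n. a \<le> l i \<and> l i \<le> r i \<and> r i \<le> b) \<longrightarrow>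
        disjoint_family_on (\<lambda>i. {l i<..<r i}) {..<n} \<longrightarrow> (\<Sum>i<n. r i - l i) < d
      \<longrightarrow> (\<Sum>i<n. \<bar>h (r i) - h (l i)\<bar>) < e"
    by (rule abs_continuous_onE[OF assms(1) \<open>e > 0\<close>])
  have "dist (h y) (h x) < e" if y: "y \<in> {a..b}" "dist y x < d" for y
    using d[rule_format, of 1 "\<lambda>_. min x y" "\<lambda>_. max x y"] x y
    by (cases "x \<le> y") (auto simp: dist_real_def disjoint_family_on_def abs_minus_commute)
  then show "\<exists>d>0. \<forall>y\<in>{a..b}. dist y x < d \<longrightarrow> dist (h y) (h x) < e"
    using \<open>d > 0\<close> by blast
qed

lemma lipschitz_imp_abs_continuous_on:
  assumes "\<And>x y. a \<le> x \<Longrightarrow> x \<le> y \<Longrightarrow> y \<le> b \<Longrightarrow> \<bar>h y - h x\<bar> \<le> B * (y - x)"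
  shows "abs_continuous_on a b h"
proof (rule abs_continuous_onI)
  fix e :: real assume e: "e > 0"
  \<comment> \<open>\<open>B\<close> may be zero or negative; \<open>B'\<close> is positive, so
    \<open>e / B'\<close> can serve as the \<open>d\<close> of absolute continuity.\<close>
  define B' where "B' = \<bar>B\<bar> + 1"
  have "(\<Sum>i<n. \<bar>h (r i) - h (l i)\<bar>) < e"
    if lr: "\<forall>i<n. a \<le> l i \<and> l i \<le> r i \<and> r i \<le> b" and d: "(\<Sum>i<n. r i - l i) < e / B'"
    for n :: nat and l r
  proof -
    have "(\<Sum>i<n. \<bar>h (r i) - h (l i)\<bar>) \<le> (\<Sum>i<n. B' * (r i - l i))"
    proof (rule sum_mono)
      fix i assume "i \<in> {..<n}"
      then have "\<bar>h (r i) - h (l i)\<bar> \<le> B * (r i - l i)" "r i - l i \<ge> 0"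
        using assms lr by auto
      moreover have "B * (r i - l i) \<le> B' * (r i - l i)"
        using \<open>r i - l i \<ge> 0\<close> by (intro mult_right_mono) (auto simp: B'_def)
      ultimately show "\<bar>h (r i) - h (l i)\<bar> \<le> B' * (r i - l i)" by simp
    qed
    also have "\<dots> = B' * (\<Sum>i<n. r i - l i)" by (simp add: sum_distrib_left)
    also have "\<dots> < e" using d by (simp add: B'_def field_simps)
    finally show ?thesis .
  qed
  moreover have "e / B' > 0" using e by (simp add: B'_def add_nonneg_pos)
  ultimately show "\<exists>d>0. \<forall>(n::nat) l r. (\<forall>i<n. a \<le> l i \<and> l i \<le> r i \<and> r i \<le> b) \<longrightarrow>
           disjoint_family_on (\<lambda>i. {l i<..<r i}) {..<n} \<longrightarrow>
           (\<Sum>i<n. r i - l i) < d \<longrightarrow> (\<Sum>i<n. \<bar>h (r i) - h (l i)\<bar>) < e"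
    by (intro exI[of _ "e / B'"]) blast
qed

text \<open>Gauge integration fits because the gauge may depend on the tag: at a differentiability
  point it confines the interval to where the linear approximation of \<open>h\<close> is good, and
  integrability of the derivative comes out together with the value of its integral.\<close>

lemma has_integral_deriv_abs_continuous:
  fixes h :: "real \<Rightarrow> real"
  assumes "a \<le> b" and ac: "abs_continuous_on a b h"
    and diff: "AE t in lborel. t \<in> {a..b} \<longrightarrow> h differentiable (at t)"
  shows "(deriv h has_integral (h b - h a)) {a..b}"
proof -
  define N where "N = {t\<in>{a..b}. \<not> h differentiable (at t)}"
  \<comment> \<open>\<open>deriv h\<close> is arbitrary on \<open>N\<close>. With the value 0 there,
    a term tagged in \<open>N\<close> consists of an increment of \<open>h\<close> alone, which is
    what absolute continuity controls.\<close>
  define f' where "f' t = (if t \<in> N then 0 else deriv h t)" for t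
  have N: "N \<in> null_sets lebesgue"
  proof -
    obtain A where "A \<in> null_sets lborel" "{t \<in> space lborel. \<not> (t \<in> {a..b} \<longrightarrow> h differentiable (at t))} \<subseteq> A"
      using diff by (auto simp: eventually_ae_filter)
    then have "N \<subseteq> A" "A \<in> null_sets lebesgue"
      by (auto simp: N_def null_sets_completionI)
    then show ?thesis by (metis completion.complete2)
  qed
  have "(f' has_integral (h b - h a)) (cbox a b)"
    unfolding has_integral
  proof (intro allI impI)
    fix e :: real assume e: "e > 0"
    \<comment> \<open>An error rate of \<open>e1\<close> over a total length of \<open>b - a\<close>
      stays below \<open>e / 2\<close>; the added 1 avoids dividing by zero if
      \<open>a = b\<close>.\<close>
    define e1 where "e1 = e / (2 * (b - a + 1))"
    have e1: "e1 > 0" using e \<open>a \<le> b\<close> by (simp add: e1_def)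
    obtain d where "d > 0" and d: "\<forall>(n::nat) l r. (\<forall>i<n. a \<le> l i \<and> l i \<le> r i \<and> r i \<le> b) \<longrightarrow>
        disjoint_family_on (\<lambda>i. {l i<..<r i}) {..<n} \<longrightarrow> (\<Sum>i<n. r i - l i) < d
      \<longrightarrow> (\<Sum>i<n. \<bar>h (r i) - h (l i)\<bar>) < e / 2"
    by (rule abs_continuous_onE[OF ac half_gt_zero[OF e]])
    obtain U where "open U" "N \<subseteq> U" and U: "U - N \<in> lmeasurable" "emeasure lebesgue (U - N) < ennreal d"
      using sets_lebesgue_outer_open[OF _ \<open>d > 0\<close>, of N] N by auto
    have emU: "emeasure lebesgue U < ennreal d"
      using U N \<open>open U\<close> by (simp add: emeasure_Diff_null_set)
    have "\<exists>r>0. \<forall>y. \<bar>y - x\<bar> < r \<longrightarrow> \<bar>h y - h x - f' x * (y - x)\<bar> \<le> e1 * \<bar>y - x\<bar>"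
      if "x \<in> {a..b} - N" for x
    proof -
      have "(h has_real_derivative f' x) (at x)"
        using that by (auto simp: N_def f'_def DERIV_deriv_iff_real_differentiable)
      then have "(h has_derivative (\<lambda>z. f' x * z)) (at x)"
        by (simp add: has_field_derivative_def)
      then show ?thesis
        using e1 unfolding has_derivative_within_alt by (force simp: real_norm_def)
    qed
    then obtain r where r: "\<And>x. x \<in> {a..b} - N \<Longrightarrow> r x > 0"
      "\<And>x y. x \<in> {a..b} - N \<Longrightarrow> \<bar>y - x\<bar> < r x \<Longrightarrow> \<bar>h y - h x - f' x * (y - x)\<bar> \<le> e1 * \<bar>y - x\<bar>"
      by metis
    \<comment> \<open>Intervals tagged in the exceptional null set stay inside \<open>U\<close>, so their total length is less than
      \<open>d\<close> and absolute continuity bounds their contribution.\<close>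
    define \<gamma> where "\<gamma> x = (if x \<in> N then U else if x \<in> {a..b} then ball x (r x) else UNIV)" for x
    have gauge: "gauge \<gamma>"
      using \<open>open U\<close> \<open>N \<subseteq> U\<close> r(1) by (auto simp: gauge_def \<gamma>_def)
    have "norm ((\<Sum>(x, K)\<in>p. measure lborel K *\<^sub>R f' x) - (h b - h a)) < e"
      if p: "p tagged_division_of cbox a b" and fine: "\<gamma> fine p" for p
    proof -
      have fin: "finite p" using p by auto
      have K: "Inf K \<in> K \<and> Sup K \<in> K \<and> Inf K \<le> x \<and> x \<le> Sup K \<and> a \<le> Inf K \<and> Sup K \<le> b
          \<and> measure lborel K = Sup K - Inf K \<and> K \<subseteq> \<gamma> x \<and> x \<in> {a..b}" if xK: "(x, K) \<in> p" for x K
      proof -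
        obtain l u where "K = {l..u}" "x \<in> K" "K \<subseteq> {a..b}"
          using tagged_division_ofD(2-4)[OF p xK] by auto
        then show ?thesis using fine xK by (auto simp: fine_def)
      qed
      define pN where "pN = {(x, K) \<in> p. x \<in> N}"
      have finN: "finite pN" "pN \<subseteq> p"
        using fin by (auto simp: pN_def intro: finite_subset)
      have "h b - h a = (\<Sum>(x,K)\<in>p. h (Sup K) - h (Inf K))" "b - a = (\<Sum>(x,K)\<in>p. Sup K - Inf K)"
        using additive_tagged_division_1[OF \<open>a \<le> b\<close>, of p h]
          additive_tagged_division_1[OF \<open>a \<le> b\<close>, of p "\<lambda>x. x"] p by auto
      then have "(\<Sum>(x, K)\<in>p. measure lborel K *\<^sub>R f' x) - (h b - h a)
          = (\<Sum>(x, K)\<in>p. measure lborel K * f' x - (h (Sup K) - h (Inf K)))"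
        by (simp add: sum_subtractf split_def)
      also have "\<dots> = (\<Sum>(x, K)\<in>pN. measure lborel K * f' x - (h (Sup K) - h (Inf K)))
          + (\<Sum>(x, K)\<in>p - pN. measure lborel K * f' x - (h (Sup K) - h (Inf K)))"
        using sum.subset_diff[OF finN(2) fin] by (simp add: add.commute)
      finally have split: "norm ((\<Sum>(x, K)\<in>p. measure lborel K *\<^sub>R f' x) - (h b - h a))
          \<le> norm (\<Sum>(x, K)\<in>pN. measure lborel K * f' x - (h (Sup K) - h (Inf K)))
          + norm (\<Sum>(x, K)\<in>p - pN. measure lborel K * f' x - (h (Sup K) - h (Inf K)))"
        by (simp only: norm_triangle_ineq)
      have "norm (\<Sum>(x, K)\<in>p - pN. measure lborel K * f' x - (h (Sup K) - h (Inf K))) < e / 2"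
      proof -
        have "norm (\<Sum>(x, K)\<in>p - pN. measure lborel K * f' x - (h (Sup K) - h (Inf K)))
            \<le> (\<Sum>(x, K)\<in>p - pN. e1 * (Sup K - Inf K))"
        proof (rule sum_norm_le, safe)
          fix x K assume xK: "(x, K) \<in> p" "(x, K) \<notin> pN"
          note KK = K[OF xK(1)]
          have x: "x \<in> {a..b} - N" using xK KK by (auto simp: pN_def)
          then have *: "K \<subseteq> ball x (r x)" using KK by (auto simp: \<gamma>_def)
          with KK have **: "\<bar>Inf K - x\<bar> < r x" "\<bar>Sup K - x\<bar> < r x"
            by (force simp: dist_real_def)+
          \<comment> \<open>Straddling: the tag lies between the two endpoints, so the errors on its
            two sides add up to \<open>e1\<close> times the full length.\<close>
          have "\<bar>measure lborel K * f' x - (h (Sup K) - h (Inf K))\<bar>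
              \<le> \<bar>h (Inf K) - h x - f' x * (Inf K - x)\<bar> + \<bar>h (Sup K) - h x - f' x * (Sup K - x)\<bar>"
          proof -
            have *: "measure lborel K = Sup K - Inf K" using KK by blast
            show ?thesis unfolding * by (simp add: algebra_simps)
          qed
          also have "\<dots> \<le> e1 * \<bar>Inf K - x\<bar> + e1 * \<bar>Sup K - x\<bar>"
            using r(2)[OF x **(1)] r(2)[OF x **(2)] by simp
          also have "\<dots> = e1 * (Sup K - Inf K)" using KK by (simp add: algebra_simps)
          finally show "norm (measure lborel K * f' x - (h (Sup K) - h (Inf K))) \<le> e1 * (Sup K - Inf K)"
            by simp
        qed
        also have "\<dots> \<le> (\<Sum>(x, K)\<in>p. e1 * (Sup K - Inf K))"
        proof (rule sum_mono2[OF fin])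
          show "0 \<le> (case z of (x, K) \<Rightarrow> e1 * (Sup K - Inf K))" if "z \<in> p - (p - pN)" for z
            using K[of "fst z" "snd z"] that e1 by (auto simp: split_def)
        qed auto
        also have "\<dots> = e1 * (b - a)"
          using \<open>b - a = _\<close> by (simp add: sum_distrib_left split_def)
        also have "\<dots> < e / 2"
          using e \<open>a \<le> b\<close> by (simp add: e1_def field_simps)
        finally show ?thesis .
      qed
      moreover have "norm (\<Sum>(x, K)\<in>pN. measure lborel K * f' x - (h (Sup K) - h (Inf K))) < e / 2"
      proof -
        \<comment> \<open>Absolute continuity speaks of finite sequences of intervals, so the pairs
          in \<open>pN\<close> are enumerated. Non-overlapping intervals inside \<open>U\<close>
          cannot have a total length above the measure of \<open>U\<close>.\<close>
        obtain \<phi> n where \<phi>: "bij_betw \<phi> {..<n::nat} pN"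
          using ex_bij_betw_nat_finite[OF finN(1)] by (auto simp: atLeast0LessThan)
        define l where "l i = Inf (snd (\<phi> i))" for i
        define u where "u i = Sup (snd (\<phi> i))" for i
        have \<phi>p: "\<phi> i \<in> p" "fst (\<phi> i) \<in> N" if "i < n" for i
          using bij_betwE[OF \<phi>, rule_format, of i] that by (auto simp: pN_def split_def)
        have lu: "snd (\<phi> i) = {l i..u i}" "a \<le> l i" "l i \<le> u i" "u i \<le> b" "{l i..u i} \<subseteq> U"
          if "i < n" for i
        proof -
          note i = that
          note KK = K[of "fst (\<phi> i)" "snd (\<phi> i)"]
          show "a \<le> l i" "l i \<le> u i" "u i \<le> b"
            using KK \<phi>p[OF i] by (auto simp: l_def u_def)
          obtain l' u' where "snd (\<phi> i) = {l'..u'}"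
            using tagged_division_ofD(4)[OF p, of "fst (\<phi> i)" "snd (\<phi> i)"] \<phi>p[OF i] by auto
          moreover from calculation have "l' \<le> u'"
            using tagged_division_ofD(2)[OF p, of "fst (\<phi> i)" "snd (\<phi> i)"] \<phi>p[OF i]
            by (metis atLeastAtMost_iff order_trans prod.collapse)
          ultimately show *: "snd (\<phi> i) = {l i..u i}" by (simp add: l_def u_def)
          show "{l i..u i} \<subseteq> U" unfolding *[symmetric]
            using KK \<phi>p[OF i] by (auto simp: \<gamma>_def)
        qed
        have disj: "disjoint_family_on (\<lambda>i. {l i<..<u i}) {..<n}"
          unfolding disjoint_family_on_def
        proof (intro ballI impI)
          fix i j assume ij: "i \<in> {..<n}" "j \<in> {..<n}" "i \<noteq> j"
          then have "\<phi> i \<noteq> \<phi> j" using \<phi> by (auto simp: bij_betw_def inj_on_def)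
          then have "interior (snd (\<phi> i)) \<inter> interior (snd (\<phi> j)) = {}"
            using tagged_division_ofD(5)[OF p, of "fst (\<phi> i)" "snd (\<phi> i)" "fst (\<phi> j)" "snd (\<phi> j)"]
              \<phi>p ij by auto
          then show "{l i<..<u i} \<inter> {l j<..<u j} = {}"
            using lu(1) ij by (simp add: interior_atLeastAtMost_real)
        qed
        have "ennreal (\<Sum>i<n. u i - l i) = (\<Sum>i<n. emeasure lebesgue {l i<..<u i})"
          using lu by (subst sum_ennreal[symmetric]) (auto intro!: sum.cong simp: emeasure_lborel_Ioo)
        also have "\<dots> = emeasure lebesgue (\<Union>i<n. {l i<..<u i})"
          using disj by (intro sum_emeasure) auto
        also have "\<dots> \<le> emeasure lebesgue U"
          using lu(5) \<open>open U\<close> by (intro emeasure_mono) (auto simp: subset_iff)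
        also have "\<dots> < ennreal d" by (rule emU)
        finally have "(\<Sum>i<n. u i - l i) < d"
          using lu(3) by (subst (asm) ennreal_less_iff) (auto intro!: sum_nonneg)
        then have small: "(\<Sum>i<n. \<bar>h (u i) - h (l i)\<bar>) < e / 2"
          using lu disj by (intro d[rule_format]) auto
        have "norm (\<Sum>(x, K)\<in>pN. measure lborel K * f' x - (h (Sup K) - h (Inf K)))
            \<le> (\<Sum>(x, K)\<in>pN. \<bar>h (Sup K) - h (Inf K)\<bar>)"
          by (intro sum_norm_le) (auto simp: pN_def f'_def)
        also have "\<dots> = (\<Sum>i<n. \<bar>h (u i) - h (l i)\<bar>)"
          by (subst sum.reindex_bij_betw[OF \<phi>, symmetric]) (simp add: l_def u_def split_def)
        finally show ?thesis using small by simp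
      qed
      ultimately show ?thesis using split by linarith
    qed
    then show "\<exists>\<gamma>. gauge \<gamma> \<and> (\<forall>\<D>. \<D> tagged_division_of cbox a b \<and> \<gamma> fine \<D> \<longrightarrow>
        norm ((\<Sum>(x, k)\<in>\<D>. measure lborel k *\<^sub>R f' x) - (h b - h a)) < e)"
      using gauge by blast
  qed
  then have f': "(f' has_integral (h b - h a)) {a..b}" by simp
  show ?thesis
  proof (rule has_integral_spike[OF _ _ f'])
    show "negligible N" using N by (simp add: negligible_iff_null_sets)
    show "deriv h x = f' x" if "x \<in> {a..b} - N" for x using that by (simp add: f'_def)
  qed
qed

section \<open>Integrating the derivative of an \<open>H1\<close> function\<close>

lemma set_integrable_L2_on:
  assumes "L2_on a b g"
  shows "set_integrable lborel {a..b} g"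
proof (rule set_integrable_bound[where f = "\<lambda>t. 1 + (g t)\<^sup>2"])
  show "set_integrable lborel {a..b} (\<lambda>t. 1 + (g t)\<^sup>2)"
    using assms by (intro set_integral_add) (auto simp: L2_on_def intro: borel_integrable_atLeastAtMost')
  show "set_borel_measurable lborel {a..b} g" using assms by (simp add: L2_on_def)
  \<comment> \<open>The difference of the two sides is
    \<open>(\<bar>g t\<bar> - 1/2)\<^sup>2 + 3/4\<close>.\<close>
  have "\<bar>g t\<bar> \<le> 1 + (g t)\<^sup>2" for t
    using zero_le_power2[of "\<bar>g t\<bar> - 1/2"] by (simp add: power2_eq_square algebra_simps)
  then show "AE x\<in>{a..b} in lborel. norm (g x) \<le> norm (1 + (g x)\<^sup>2)"
    by (intro always_eventually) (auto simp: abs_of_nonneg)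
qed

text \<open>The gauge integral is a Lebesgue integral here because \<open>deriv h\<close> is square
  integrable on a bounded interval. The half-open interval matches the cells of
  \<open>simple_process\<close>.\<close>

lemma H1_increment:
  assumes "h \<in> H1 a b" "a \<le> x" "x \<le> y" "y \<le> b"
  shows "(\<integral>t. indicator {x<..y} t * deriv h t \<partial>lborel) = h y - h x"
proof -
  have h: "abs_continuous_on a b h" "AE t in lborel. t \<in> {a..b} \<longrightarrow> h differentiable (at t)"
    "L2_on a b (deriv h)"
    using assms by (auto simp: H1_def)
  have int: "set_integrable lborel {x..y} (deriv h)"
    using set_integrable_L2_on[OF h(3)] assms by (auto intro: set_integrable_subset)
  then have "(LINT t:{x..y}|lborel. deriv h t) = integral {x..y} (deriv h)"
    by (rule set_borel_integral_eq_integral)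
  also have "\<dots> = h y - h x"
    by (intro integral_unique has_integral_deriv_abs_continuous abs_continuous_on_subinterval[OF h(1)] assms)
       (use h(2) in eventually_elim, use assms in auto)
  also have "(LINT t:{x..y}|lborel. deriv h t) = (\<integral>t. indicator {x<..y} t * deriv h t \<partial>lborel)"
    unfolding set_lebesgue_integral_def
  proof (rule integral_cong_AE)
    show "(\<lambda>t. indicator {x..y} t *\<^sub>R deriv h t) \<in> borel_measurable lborel"
      using int by (auto simp: set_integrable_def)
    then have "(\<lambda>t. indicator {x<..y} t * (indicator {x..y} t *\<^sub>R deriv h t)) \<in> borel_measurable lborel"
      by measurable
    also have "(\<lambda>t. indicator {x<..y} t * (indicator {x..y} t *\<^sub>R deriv h t)) = (\<lambda>t. indicator {x<..y} t * deriv h t)"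
      by (auto simp: indicator_def)
    finally show "(\<lambda>t. indicator {x<..y} t * deriv h t) \<in> borel_measurable lborel" .
    show "AE t in lborel. indicator {x..y} t *\<^sub>R deriv h t = indicator {x<..y} t * deriv h t"
      using AE_lborel_singleton[of x] by eventually_elim (auto simp: indicator_def)
  qed
  finally show ?thesis .
qed

section \<open>Step functions on uniform grids\<close>

text \<open>Index \<open>k\<close> stands for \<open>k + 1\<close> cells, so the mesh is well
  defined for every natural number and the grids form a sequence indexed from 0.\<close>

definition grid :: "real \<Rightarrow> real \<Rightarrow> nat \<Rightarrow> nat \<Rightarrow> real" where
  "grid a b k i = a + real i * ((b - a) / real (Suc k))"

lemma grid_0 [simp]: "grid a b k 0 = a"
  by (simp add: grid_def)

lemma grid_Suc_self [simp]: "grid a b k (Suc k) = b"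
  by (simp add: grid_def)

lemma grid_Suc_diff: "grid a b k (Suc i) - grid a b k i = (b - a) / real (Suc k)"
  by (simp add: grid_def algebra_simps add_divide_distrib del: of_nat_Suc) (simp add: algebra_simps add_divide_distrib diff_divide_distrib)

lemma grid_mono: "a \<le> b \<Longrightarrow> i \<le> j \<Longrightarrow> grid a b k i \<le> grid a b k j"
  unfolding grid_def by (intro add_left_mono mult_right_mono) auto

lemma grid_in_interval: "a \<le> b \<Longrightarrow> i \<le> Suc k \<Longrightarrow> grid a b k i \<in> {a..b}"
  using grid_mono[of a b 0 i k] grid_mono[of a b i "Suc k" k] by simp

text \<open>The half-open cells partition \<open>{a<..b}\<close>, so a single cell decides the
  value. It depends on \<open>t\<close> and the grid alone, so one index serves all heights
  \<open>\<xi>\<close>.\<close>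

lemma simple_process_grid_eq:
  fixes \<omega> :: 'w
  assumes "a < b" "t \<in> {a<..b}"
  obtains i where "i < Suc k" "grid a b k i < t" "t \<le> grid a b k (Suc i)"
    "\<forall>\<xi>. simple_process (Suc k) (grid a b k) \<xi> t \<omega> = \<xi> i \<omega>"
proof -
  \<comment> \<open>The first grid point not before \<open>t\<close> is the right end of the cell
    containing \<open>t\<close>; it is not \<open>a\<close> itself because
    \<open>a < t\<close>.\<close>
  define j where "j = (LEAST j. t \<le> grid a b k j)"
  have ex: "t \<le> grid a b k (Suc k)" using assms by simp
  have tj: "t \<le> grid a b k j" "j \<le> Suc k"
    using LeastI[of "\<lambda>j. t \<le> grid a b k j", OF ex] Least_le[of "\<lambda>j. t \<le> grid a b k j", OF ex]
    by (auto simp: j_def)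
  have "j \<noteq> 0" using tj assms by (auto intro!: gr0I)
  then obtain i where i: "j = Suc i" by (cases j) auto
  have ti: "grid a b k i < t"
    using not_less_Least[of i "\<lambda>j. t \<le> grid a b k j"] i by (auto simp: j_def)
  have "simple_process (Suc k) (grid a b k) \<xi> t \<omega> = \<xi> i \<omega>" for \<xi>
  proof -
    have "\<xi> l \<omega> * indicator {grid a b k l<..grid a b k (Suc l)} t = (if l = i then \<xi> i \<omega> else 0)" for l
    proof (cases l i rule: linorder_cases)
      case less
      then have "grid a b k (Suc l) \<le> grid a b k i" using assms by (intro grid_mono) auto
      then show ?thesis using ti less by (auto simp: indicator_def)
    next
      case equal
      then show ?thesis using ti tj i by (auto simp: indicator_def)
    next
      case greater
      then have "grid a b k (Suc i) \<le> grid a b k l" using assms by (intro grid_mono) auto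
      then show ?thesis using tj i greater by (auto simp: indicator_def)
    qed
    then show ?thesis using tj i by (simp add: simple_process_def del: sum.lessThan_Suc)
  qed
  then show ?thesis using that[of i] ti tj i by auto
qed

text \<open>Uniform continuity bounds the oscillation of \<open>F\<close> within a cell. The
  sampling points \<open>\<sigma>\<close> are left free because both ends are wanted: left ones for
  adapted integrands, right ones for the sums produced by summation by parts. \<open>F\<close> is a
  single path, regarded as a process constant in \<open>\<omega>\<close>. The point \<open>a\<close>
  lies in no cell and is excluded.\<close>

lemma simple_process_grid_uniform:
  fixes \<omega> :: 'w and F :: "real \<Rightarrow> real"
  assumes "a < b" "continuous_on {a..b} F" "e > 0"
  shows "\<forall>\<^sub>F k in sequentially. \<forall>t\<in>{a<..b}. \<forall>\<sigma>.
      (\<forall>i<Suc k. \<sigma> i \<in> {grid a b k i..grid a b k (Suc i)}) \<longrightarrow>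
      \<bar>simple_process (Suc k) (grid a b k) (\<lambda>i _. F (\<sigma> i)) t \<omega> - F t\<bar> < e"
proof -
  obtain d where "d > 0" and d: "\<And>s t. s \<in> {a..b} \<Longrightarrow> t \<in> {a..b} \<Longrightarrow> \<bar>s - t\<bar> < d \<Longrightarrow> \<bar>F s - F t\<bar> < e"
    using compact_uniformly_continuous[OF assms(2)] assms(3)
    unfolding uniformly_continuous_on_def dist_real_def by (metis compact_Icc)
  have "(\<lambda>k. (b - a) / real (Suc k)) \<longlonglongrightarrow> 0"
    using LIMSEQ_inverse_real_of_nat[THEN tendsto_mult_left, of "b - a"] by (simp add: divide_inverse)
  then have "\<forall>\<^sub>F k in sequentially. (b - a) / real (Suc k) < d"
    using \<open>d > 0\<close> by (rule order_tendstoD)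
  then show ?thesis
  proof eventually_elim
    case (elim k)
    show ?case
    proof (intro ballI allI impI)
      fix t \<sigma> assume t: "t \<in> {a<..b}" and \<sigma>: "\<forall>i<Suc k. \<sigma> i \<in> {grid a b k i..grid a b k (Suc i)}"
      obtain i where i: "i < Suc k" "grid a b k i < t" "t \<le> grid a b k (Suc i)"
        "\<forall>\<xi>. simple_process (Suc k) (grid a b k) \<xi> t \<omega> = \<xi> i \<omega>"
        by (rule simple_process_grid_eq[OF assms(1) t, of k \<omega>])
      have "\<sigma> i \<in> {grid a b k i..grid a b k (Suc i)}" using \<sigma> i(1) by blast
      moreover have "grid a b k i \<in> {a..b}" "grid a b k (Suc i) \<in> {a..b}"
        using assms(1) i(1) by (auto intro!: grid_in_interval simp del: atLeastAtMost_iff)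
      moreover note grid_Suc_diff[of a b k i] elim i(2,3)
      ultimately have "\<bar>F (\<sigma> i) - F t\<bar> < e"
        using t by (intro d) auto
      then show "\<bar>simple_process (Suc k) (grid a b k) (\<lambda>i _. F (\<sigma> i)) t \<omega> - F t\<bar> < e"
        by (simp add: i(4))
    qed
  qed
qed

text \<open>Dominated convergence of the indicators with bound 1. It turns statements about each
  path into the limits in probability that \<open>has_ito_integral\<close> asks for.\<close>

lemma (in prob_space) prob_tendsto_0_if_eventually_notin:
  assumes "\<And>k::nat. A k \<in> events" "\<And>\<omega>. \<omega> \<in> space M \<Longrightarrow> \<forall>\<^sub>F k in sequentially. \<omega> \<notin> A k"
  shows "(\<lambda>k. prob (A k)) \<longlonglongrightarrow> 0"
proof -
  have "(\<lambda>k. expectation (indicator (A k) :: _ \<Rightarrow> real)) \<longlonglongrightarrow> expectation (\<lambda>_. 0)"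
  proof (rule integral_dominated_convergence[where w = "\<lambda>_. 1"])
    show "AE \<omega> in M. (\<lambda>k. indicator (A k) \<omega> :: real) \<longlonglongrightarrow> 0"
    proof (rule AE_I2)
      fix \<omega> assume "\<omega> \<in> space M"
      from assms(2)[OF this] show "(\<lambda>k. indicator (A k) \<omega> :: real) \<longlonglongrightarrow> 0"
        by (intro tendsto_eventually) (auto elim!: eventually_mono)
    qed
  qed (use assms(1) in \<open>auto simp: indicator_def\<close>)
  then show ?thesis using assms(1) by simp
qed

section \<open>Joint measurability in time and path\<close>

lemma borel_measurable_simple_process:
  fixes \<xi> :: "nat \<Rightarrow> 'w \<Rightarrow> real"
  assumes "\<And>i. i < n \<Longrightarrow> \<xi> i \<in> borel_measurable M"
  shows "(\<lambda>(t, \<omega>). simple_process n \<tau> \<xi> t \<omega>)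
    \<in> borel_measurable (restrict_space lborel A \<Otimes>\<^sub>M M)"
proof -
  have "(\<lambda>x. \<xi> i (snd x) * indicator {\<tau> i<..\<tau> (Suc i)} (fst x))
      \<in> borel_measurable (restrict_space lborel A \<Otimes>\<^sub>M M)" if "i < n" for i
    by (intro borel_measurable_times measurable_compose[OF measurable_snd assms[OF that]]
        measurable_compose[OF measurable_fst]) (auto intro!: measurable_restrict_space1)
  then show ?thesis
    unfolding simple_process_def split_beta by (intro borel_measurable_sum) auto
qed

text \<open>Left-endpoint step processes are jointly measurable, being finite sums of functions of
  \<open>\<omega>\<close> times indicators in \<open>t\<close>, and continuity of the paths makes
  them converge pointwise.\<close>

lemma continuous_process_jointly_measurable:
  fixes F :: "real \<Rightarrow> 'w \<Rightarrow> real"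
  assumes "a < b" and F: "\<And>t. t \<in> {a..b} \<Longrightarrow> F t \<in> borel_measurable M"
    and cont: "\<And>\<omega>. \<omega> \<in> space M \<Longrightarrow> continuous_on {a..b} (\<lambda>t. F t \<omega>)"
  shows "(\<lambda>(t, \<omega>). F t \<omega>) \<in> borel_measurable (restrict_space lborel {a..b} \<Otimes>\<^sub>M M)"
proof (rule borel_measurable_LIMSEQ_metric)
  let ?R = "restrict_space lborel {a..b}"
  \<comment> \<open>No cell contains \<open>a\<close>, so the value there is added
    separately.\<close>
  let ?U = "\<lambda>k x. simple_process (Suc k) (grid a b k) (\<lambda>i. F (grid a b k i)) (fst x) (snd x)
      + F a (snd x) * indicator {a} (fst x)"
  show "?U k \<in> borel_measurable (?R \<Otimes>\<^sub>M M)" for k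
  proof (rule borel_measurable_add)
    show "(\<lambda>x. simple_process (Suc k) (grid a b k) (\<lambda>i. F (grid a b k i)) (fst x) (snd x))
        \<in> borel_measurable (?R \<Otimes>\<^sub>M M)"
      using borel_measurable_simple_process[of "Suc k" "\<lambda>i. F (grid a b k i)" M "grid a b k" "{a..b}"]
        F grid_in_interval[of a b _ k] assms(1) by (simp add: split_beta)
    show "(\<lambda>x. F a (snd x) * indicator {a} (fst x)) \<in> borel_measurable (?R \<Otimes>\<^sub>M M)"
      using F[of a] assms(1)
      by (intro borel_measurable_times measurable_compose[OF measurable_snd] measurable_compose[OF measurable_fst])
        (auto intro!: measurable_restrict_space1)
  qed
  show "(\<lambda>k. ?U k x) \<longlonglongrightarrow> (\<lambda>(t, \<omega>). F t \<omega>) x" if x: "x \<in> space (?R \<Otimes>\<^sub>M M)" for x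
  proof -
    obtain t \<omega> where x: "x = (t, \<omega>)" "t \<in> {a..b}" "\<omega> \<in> space M"
      using x by (auto simp: space_pair_measure space_restrict_space)
    show ?thesis
    proof (cases "t = a")
      case True
      have "simple_process (Suc k) (grid a b k) \<xi> a \<omega> = 0" for k \<xi>
        unfolding simple_process_def
        using grid_mono[of a b 0 _ k] assms(1) by (intro sum.neutral) (auto simp: indicator_def not_less)
      then show ?thesis using True x by simp
    next
      case False
      then have t: "t \<in> {a<..b}" using x by auto
      have "(\<lambda>k. simple_process (Suc k) (grid a b k) (\<lambda>i. F (grid a b k i)) t \<omega>) \<longlonglongrightarrow> F t \<omega>"
      proof (rule tendstoI)
        fix e :: real assume "e > 0"
        from simple_process_grid_uniform[OF assms(1) cont[OF x(3)] this, of \<omega>]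
        show "\<forall>\<^sub>F k in sequentially. dist (simple_process (Suc k) (grid a b k) (\<lambda>i. F (grid a b k i)) t \<omega>) (F t \<omega>) < e"
        proof eventually_elim
          case (elim k)
          show ?case
            using elim[rule_format, OF t, of "grid a b k"] assms(1)
            by (simp add: dist_real_def simple_process_def grid_mono)
        qed
      qed
      then show ?thesis using False x by simp
    qed
  qed
qed

text \<open>The measurability part of Fubini's theorem over Lebesgue measure restricted to
  \<open>{a..b}\<close>, which is finite; the swap makes time the integrated coordinate.\<close>

lemma borel_measurable_set_integral_parameter:
  fixes f :: "real \<Rightarrow> 'w \<Rightarrow> real"
  assumes "(\<lambda>(t, \<omega>). f t \<omega>) \<in> borel_measurable (restrict_space lborel {a..b} \<Otimes>\<^sub>M M)"
  shows "(\<lambda>\<omega>. LINT t:{a..b}|lborel. f t \<omega>) \<in> borel_measurable M"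
proof -
  interpret R: finite_measure "restrict_space lborel {a..b}"
    by (rule finite_measureI) (simp add: emeasure_restrict_space space_restrict_space emeasure_lborel_Icc_eq)
  have "(\<lambda>x. (\<lambda>(t, \<omega>). f t \<omega>) (snd x, fst x)) \<in> borel_measurable (M \<Otimes>\<^sub>M restrict_space lborel {a..b})"
    using measurable_pair_swap[OF assms] by (simp add: split_beta)
  then have "(\<lambda>\<omega>. \<integral>t. f t \<omega> \<partial>restrict_space lborel {a..b}) \<in> borel_measurable M"
    by (intro R.borel_measurable_lebesgue_integral) (simp add: split_beta)
  then show ?thesis by (simp add: integral_restrict_space set_lebesgue_integral_def)
qed

lemma borel_measurable_set_nn_integral_parameter:
  fixes f :: "real \<Rightarrow> 'w \<Rightarrow> ennreal"
  assumes "(\<lambda>(t, \<omega>). f t \<omega>) \<in> borel_measurable (restrict_space lborel {a..b} \<Otimes>\<^sub>M M)"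
  shows "(\<lambda>\<omega>. \<integral>\<^sup>+t\<in>{a..b}. f t \<omega> \<partial>lborel) \<in> borel_measurable M"
proof -
  interpret R: finite_measure "restrict_space lborel {a..b}"
    by (rule finite_measureI) (simp add: emeasure_restrict_space space_restrict_space emeasure_lborel_Icc_eq)
  have "(\<lambda>x. (\<lambda>(t, \<omega>). f t \<omega>) (snd x, fst x)) \<in> borel_measurable (M \<Otimes>\<^sub>M restrict_space lborel {a..b})"
    using measurable_pair_swap[OF assms] by (simp add: split_beta)
  then have "(\<lambda>\<omega>. \<integral>\<^sup>+t. f t \<omega> \<partial>restrict_space lborel {a..b}) \<in> borel_measurable M"
    by (intro R.borel_measurable_nn_integral) (simp add: split_beta)
  then show ?thesis by (simp add: nn_integral_restrict_space)
qed

section \<open>Exponentials of Gaussian increments\<close>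

text \<open>Exponential tilting: by completing the square, \<open>exp (c * x)\<close> times the
  centred Gaussian density is a constant times the Gaussian density with mean
  \<open>c * \<sigma>\<^sup>2\<close>. The two claims read off its mass and its mean.\<close>

lemma normal_density_exp_moments:
  assumes "\<sigma> > 0"
  shows "has_bochner_integral lborel (\<lambda>x. normal_density 0 \<sigma> x * exp (c * x)) (exp (c\<^sup>2 * \<sigma>\<^sup>2 / 2))"
    and "has_bochner_integral lborel (\<lambda>x. normal_density 0 \<sigma> x * (x * exp (c * x)))
           (c * \<sigma>\<^sup>2 * exp (c\<^sup>2 * \<sigma>\<^sup>2 / 2))"
proof -
  have tilt: "normal_density 0 \<sigma> x * exp (c * x) = exp (c\<^sup>2 * \<sigma>\<^sup>2 / 2) * normal_density (c * \<sigma>\<^sup>2) \<sigma> x" for x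
  proof -
    have "- x\<^sup>2 / (2 * \<sigma>\<^sup>2) + c * x = c\<^sup>2 * \<sigma>\<^sup>2 / 2 + - (x - c * \<sigma>\<^sup>2)\<^sup>2 / (2 * \<sigma>\<^sup>2)"
      using assms by (simp add: field_simps power2_eq_square)
    then have "exp (- x\<^sup>2 / (2 * \<sigma>\<^sup>2)) * exp (c * x) = exp (c\<^sup>2 * \<sigma>\<^sup>2 / 2) * exp (- (x - c * \<sigma>\<^sup>2)\<^sup>2 / (2 * \<sigma>\<^sup>2))"
      by (simp only: exp_add[symmetric])
    then show ?thesis by (simp add: normal_density_def)
  qed
  have "has_bochner_integral lborel (normal_density (c * \<sigma>\<^sup>2) \<sigma>) 1"
    using assms by (simp add: has_bochner_integral_iff)
  from has_bochner_integral_mult_right[OF this, of "exp (c\<^sup>2 * \<sigma>\<^sup>2 / 2)"]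
  show "has_bochner_integral lborel (\<lambda>x. normal_density 0 \<sigma> x * exp (c * x)) (exp (c\<^sup>2 * \<sigma>\<^sup>2 / 2))"
    by (simp add: tilt)
  have "normal_density 0 \<sigma> x * (x * exp (c * x)) = exp (c\<^sup>2 * \<sigma>\<^sup>2 / 2) * (normal_density (c * \<sigma>\<^sup>2) \<sigma> x * x)" for x
    using tilt[of x] by (simp add: algebra_simps)
  then have *: "(\<lambda>x. normal_density 0 \<sigma> x * (x * exp (c * x)))
      = (\<lambda>x. exp (c\<^sup>2 * \<sigma>\<^sup>2 / 2) * (normal_density (c * \<sigma>\<^sup>2) \<sigma> x * x))" by blast
  show "has_bochner_integral lborel (\<lambda>x. normal_density 0 \<sigma> x * (x * exp (c * x)))
           (c * \<sigma>\<^sup>2 * exp (c\<^sup>2 * \<sigma>\<^sup>2 / 2))"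
    unfolding * mult.commute[of "c * \<sigma>\<^sup>2"]
    by (rule has_bochner_integral_mult_right[OF normal_moment_nz_1[OF assms]])
qed

lemma normal_density_second_moment:
  assumes "\<sigma> > 0"
  shows "has_bochner_integral lborel (\<lambda>x. normal_density 0 \<sigma> x * x\<^sup>2) (\<sigma>\<^sup>2)"
  using normal_moment_even[OF assms, of 0 1] by (simp add: fact_numeral)

lemma distributed_has_bochner_integral:
  fixes X :: "'w \<Rightarrow> real"
  assumes "distributed M lborel X f" "g \<in> borel_measurable borel" "\<And>x. 0 \<le> f x"
    "has_bochner_integral lborel (\<lambda>x. f x * g x) v"
  shows "has_bochner_integral M (\<lambda>\<omega>. g (X \<omega>) :: real) v"
  using distributed_integral[OF assms(1), of g] distributed_integrable[OF assms(1), of g] assms(2-4)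
  by (simp add: has_bochner_integral_iff)

text \<open>If \<open>x\<close> is the Brownian increment over a step of length
  \<open>\<delta>\<close>, this is the ratio of geometric Brownian motion at the two ends of the
  step; the shift by \<open>\<delta> / 2\<close> normalises its mean to 1.\<close>

definition exp_increment :: "real \<Rightarrow> real \<Rightarrow> real" where
  "exp_increment \<delta> x = exp (x - \<delta> / 2)"

text \<open>Error of replacing that ratio by the Euler factor \<open>1 + x\<close>.\<close>

definition exp_remainder :: "real \<Rightarrow> real \<Rightarrow> real" where
  "exp_remainder \<delta> x = exp_increment \<delta> x - 1 - x"

lemma measurable_exp_increment [measurable]: "exp_increment \<delta> \<in> borel_measurable borel"
  unfolding exp_increment_def by measurable

lemma measurable_exp_remainder [measurable]: "exp_remainder \<delta> \<in> borel_measurable borel"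
  unfolding exp_remainder_def by measurable

text \<open>Everything comes from the means of \<open>exp (c * X)\<close> for c = 1, 2, those of
  \<open>X * exp (c * X)\<close> for c = 0, 1, and the variance. The last item serves the index
  where, in a product of two martingale differences, one ends in its remainder while the other still
  has an increment factor.\<close>

lemma (in prob_space) normal_exp_moments:
  assumes "\<delta> > 0" and X: "distributed M lborel X (normal_density 0 (sqrt \<delta>))"
  shows "has_bochner_integral M (\<lambda>\<omega>. exp_increment \<delta> (X \<omega>)) 1"
    and "has_bochner_integral M (\<lambda>\<omega>. (exp_increment \<delta> (X \<omega>))\<^sup>2) (exp \<delta>)"
    and "has_bochner_integral M (\<lambda>\<omega>. exp_remainder \<delta> (X \<omega>)) 0"
    and "has_bochner_integral M (\<lambda>\<omega>. (exp_remainder \<delta> (X \<omega>))\<^sup>2) (exp \<delta> - 1 - \<delta>)"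
    and "integrable M (\<lambda>\<omega>. exp_increment \<delta> (X \<omega>) * exp_remainder \<delta> (X \<omega>))"
proof -
  have \<sigma>: "sqrt \<delta> > 0" using assms by simp
  have E: "has_bochner_integral M (\<lambda>\<omega>. exp (c * X \<omega>)) (exp (c\<^sup>2 * \<delta> / 2))" for c
    using distributed_has_bochner_integral[OF X _ _ normal_density_exp_moments(1)[OF \<sigma>], of c] assms(1) by simp
  have XE: "has_bochner_integral M (\<lambda>\<omega>. X \<omega> * exp (c * X \<omega>)) (c * \<delta> * exp (c\<^sup>2 * \<delta> / 2))" for c
    using distributed_has_bochner_integral[OF X _ _ normal_density_exp_moments(2)[OF \<sigma>], of c] assms(1) by simp
  have X2: "has_bochner_integral M (\<lambda>\<omega>. (X \<omega>)\<^sup>2) \<delta>"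
    using distributed_has_bochner_integral[OF X _ _ normal_density_second_moment[OF \<sigma>]] assms(1) by simp
  have X1: "has_bochner_integral M X 0" using XE[of 0] by simp
  have one: "has_bochner_integral M (\<lambda>_. 1 :: real) 1"
    by (simp add: has_bochner_integral_iff prob_space)
  show e: "has_bochner_integral M (\<lambda>\<omega>. exp_increment \<delta> (X \<omega>)) 1"
    using has_bochner_integral_mult_left[OF E[of 1], of "exp (- (\<delta> / 2))"]
    by (simp add: exp_increment_def exp_add[symmetric])
  have "(\<lambda>\<omega>. exp (2 * X \<omega>) * exp (- \<delta>)) = (\<lambda>\<omega>. (exp_increment \<delta> (X \<omega>))\<^sup>2)"
    by (auto simp: exp_increment_def power2_eq_square exp_add[symmetric])
  moreover have "exp (2\<^sup>2 * \<delta> / 2) * exp (- \<delta>) = exp \<delta>"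
    by (simp add: exp_add[symmetric])
  ultimately show e2: "has_bochner_integral M (\<lambda>\<omega>. (exp_increment \<delta> (X \<omega>))\<^sup>2) (exp \<delta>)"
    using has_bochner_integral_mult_left[OF E[of 2], of "exp (- \<delta>)"] by simp
  have "(\<lambda>\<omega>. X \<omega> * exp (1 * X \<omega>) * exp (- (\<delta> / 2))) = (\<lambda>\<omega>. X \<omega> * exp_increment \<delta> (X \<omega>))"
    by (auto simp: exp_increment_def exp_add[symmetric] mult.assoc)
  moreover have "1 * \<delta> * exp (1\<^sup>2 * \<delta> / 2) * exp (- (\<delta> / 2)) = \<delta>"
    by (simp add: exp_add[symmetric])
  ultimately have xe: "has_bochner_integral M (\<lambda>\<omega>. X \<omega> * exp_increment \<delta> (X \<omega>)) \<delta>"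
    using has_bochner_integral_mult_left[OF XE[of 1], of "exp (- (\<delta> / 2))"] by metis
  show "has_bochner_integral M (\<lambda>\<omega>. exp_remainder \<delta> (X \<omega>)) 0"
    using has_bochner_integral_diff[OF has_bochner_integral_diff[OF e one] X1]
    by (simp add: exp_remainder_def)
  have "(exp_remainder \<delta> x)\<^sup>2 = (exp_increment \<delta> x)\<^sup>2 + 1 + x\<^sup>2 - exp_increment \<delta> x * 2
      - x * exp_increment \<delta> x * 2 + x * 2" for x
    by (simp add: exp_remainder_def power2_eq_square algebra_simps)
  \<comment> \<open>The value is written with the same operations as the expanded square, so that
    the means combine term by term; the final \<open>0 * 2\<close> is the mean of
    \<open>x * 2\<close>.\<close>
  moreover have "exp \<delta> - 1 - \<delta> = exp \<delta> + 1 + \<delta> - 1 * 2 - \<delta> * 2 + 0 * 2"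
    by simp
  ultimately show "has_bochner_integral M (\<lambda>\<omega>. (exp_remainder \<delta> (X \<omega>))\<^sup>2) (exp \<delta> - 1 - \<delta>)"
    by (simp only:) (intro has_bochner_integral_add has_bochner_integral_diff
        has_bochner_integral_mult_left e e2 xe one X1 X2)
  have "exp_increment \<delta> x * exp_remainder \<delta> x
      = (exp_increment \<delta> x)\<^sup>2 - exp_increment \<delta> x - x * exp_increment \<delta> x" for x
    by (simp add: exp_remainder_def power2_eq_square algebra_simps)
  then show "integrable M (\<lambda>\<omega>. exp_increment \<delta> (X \<omega>) * exp_remainder \<delta> (X \<omega>))"
    using e e2 xe by (simp add: has_bochner_integral_iff)
qed

text \<open>
  Each product of two differences factorises over the independent increments, and for \<open>i < j\<close> the
  factor belonging to \<open>X j\<close> is a remainder, which has mean zero.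
\<close>

lemma (in prob_space) martingale_difference_second_moments:
  fixes X :: "nat \<Rightarrow> 'a \<Rightarrow> real" and \<delta> :: real
  defines "D \<equiv> \<lambda>i \<omega>. (\<Prod>l<i. exp_increment \<delta> (X l \<omega>)) * exp_remainder \<delta> (X i \<omega>)"
  assumes "\<delta> > 0" and indep: "indep_vars (\<lambda>_. borel) X {..<n}"
    and X: "\<And>i. i < n \<Longrightarrow> distributed M lborel (X i) (normal_density 0 (sqrt \<delta>))"
    and ij: "i \<le> j" "j < n"
  shows "has_bochner_integral M (\<lambda>\<omega>. D i \<omega> * D j \<omega>)
    (if i = j then exp \<delta> ^ i * (exp \<delta> - 1 - \<delta>) else 0)"
proof -
  \<comment> \<open>\<open>f l\<close> collects the factors of \<open>D i * D j\<close> that depend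
    on \<open>X l\<close>, and is 1 beyond \<open>j\<close>. Independence then turns the mean of the
    product into the product of the means.\<close>
  define f where "f l x = (if l < i then exp_increment \<delta> x else 1) * (if l = i then exp_remainder \<delta> x else 1)
    * ((if l < j then exp_increment \<delta> x else 1) * (if l = j then exp_remainder \<delta> x else 1))" for l x
  \<comment> \<open>On the diagonal all means are explicit. Off the diagonal the zero at
    \<open>l = j\<close> annihilates the product, so the other means can stay unevaluated once
    integrability is known.\<close>
  define m where "m l = (if i = j then if l < i then exp \<delta> else if l = i then exp \<delta> - 1 - \<delta> else 1
    else if l = j then 0 else expectation (\<lambda>\<omega>. f l (X l \<omega>)))" for l
  have f: "has_bochner_integral M (\<lambda>\<omega>. f l (X l \<omega>)) (m l)" if "l < n" for l
  proof -
    note mom = normal_exp_moments[OF \<open>\<delta> > 0\<close> X[OF that]]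
    have one: "has_bochner_integral M (\<lambda>_. 1 :: real) 1"
      by (simp add: has_bochner_integral_iff prob_space)
    have sq: "integrable M (\<lambda>\<omega>. exp_increment \<delta> (X l \<omega>) * exp_increment \<delta> (X l \<omega>))"
      using mom(2) by (simp add: power2_eq_square has_bochner_integral_iff)
    show ?thesis
    proof (cases "i = j")
      case True
      show ?thesis
        using mom(2,4) one True
        by (cases l i rule: linorder_cases) (simp_all add: f_def m_def power2_eq_square)
    next
      case False
      have ints: "integrable M (\<lambda>\<omega>. exp_increment \<delta> (X l \<omega>))" "integrable M (\<lambda>\<omega>. exp_remainder \<delta> (X l \<omega>))"
        using mom(1,3) by (simp_all add: has_bochner_integral_iff)
      consider "l < i" | "l = i" | "i < l" "l < j" | "l = j" | "l > j" using ij by linarith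
      then show ?thesis
      proof cases
        case 4
        then show ?thesis using mom(3) False ij by (simp add: f_def m_def)
      qed (use sq ints mom(5) False ij in \<open>simp_all add: f_def m_def has_bochner_integral_iff mult.commute\<close>)
    qed
  qed
  have meas: "f l \<in> borel_measurable borel" for l
    unfolding f_def by measurable
  have indep': "indep_vars (\<lambda>_. borel) (\<lambda>l \<omega>. f l (X l \<omega>)) {..<n}"
    by (rule indep_vars_compose2[OF indep]) (simp add: meas)
  have "integrable M (\<lambda>\<omega>. f l (X l \<omega>))" if "l \<in> {..<n}" for l
    using f that by (auto simp: has_bochner_integral_iff)
  note * = indep_vars_lebesgue_integral[OF finite_lessThan indep' this]
    indep_vars_integrable[OF finite_lessThan indep' this]
  have split1: "(\<Prod>l<n. (if l < i' then g l else 1) * (if l = i' then r l else 1)) = (\<Prod>l<i'. g l) * r i'"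
    if "i' < n" for g r :: "nat \<Rightarrow> real" and i'
  proof -
    have "{..<n} \<inter> {l. l < i'} = {..<i'}" using that by auto
    then show ?thesis
      using that by (simp add: prod.distrib prod.If_cases prod.delta)
  qed
  have prod: "(\<Prod>l<n. f l (X l \<omega>)) = D i \<omega> * D j \<omega>" for \<omega>
    unfolding f_def D_def using ij
    by (subst prod.distrib) (simp add: split1)
  have "(\<Prod>l<n. expectation (\<lambda>\<omega>. f l (X l \<omega>))) = (\<Prod>l<n. m l)"
    using f by (intro prod.cong) (auto simp: has_bochner_integral_iff)
  also have "\<dots> = (if i = j then exp \<delta> ^ i * (exp \<delta> - 1 - \<delta>) else 0)"
  proof (cases "i = j")
    case True
    have "m l = (if l < i then exp \<delta> else 1) * (if l = i then exp \<delta> - 1 - \<delta> else 1)" for l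
      using True by (simp add: m_def)
    then show ?thesis using split1[of i "\<lambda>_. exp \<delta>" "\<lambda>_. exp \<delta> - 1 - \<delta>"] True ij by simp
  next
    case False
    then have "m j = 0" by (simp add: m_def)
    then show ?thesis using False ij by (auto intro!: prod_zero)
  qed
  finally show ?thesis
    using * by (simp add: has_bochner_integral_iff prod)
qed

text \<open>Chebyshev's inequality. The off-diagonal products vanish in mean, so the second moment
  of the sum has only diagonal terms. Bounding \<open>exp \<delta> ^ i\<close> by
  \<open>exp (real n * \<delta>)\<close> is harmless because \<open>real n * \<delta>\<close> equals
  \<open>b - a\<close> on every grid.\<close>

lemma (in prob_space) martingale_difference_sum_prob_le:
  fixes X :: "nat \<Rightarrow> 'a \<Rightarrow> real" and \<delta> :: real
  defines "D \<equiv> \<lambda>i \<omega>. (\<Prod>l<i. exp_increment \<delta> (X l \<omega>)) * exp_remainder \<delta> (X i \<omega>)"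
  assumes "\<delta> > 0" and indep: "indep_vars (\<lambda>_. borel) X {..<n}"
    and X: "\<And>i. i < n \<Longrightarrow> distributed M lborel (X i) (normal_density 0 (sqrt \<delta>))"
    and c: "\<And>i. i < n \<Longrightarrow> \<bar>c i\<bar> \<le> B" and "e > 0"
  shows "prob {\<omega>\<in>space M. \<bar>\<Sum>i<n. c i * D i \<omega>\<bar> > e}
    \<le> real n * (B\<^sup>2 * (exp (real n * \<delta>) * (exp \<delta> - 1 - \<delta>))) / e\<^sup>2"
proof -
  let ?\<rho> = "exp \<delta> - 1 - \<delta>"
  have \<rho>: "?\<rho> \<ge> 0" using exp_ge_add_one_self[of \<delta>] by linarith
  have DD: "has_bochner_integral M (\<lambda>\<omega>. D i \<omega> * D j \<omega>) (if i = j then exp \<delta> ^ i * ?\<rho> else 0)"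
    if "i < n" "j < n" for i j
  proof (cases "i \<le> j")
    case True
    then show ?thesis unfolding D_def
      using martingale_difference_second_moments[OF \<open>\<delta> > 0\<close> indep X] that by blast
  next
    case False
    have "has_bochner_integral M (\<lambda>\<omega>. D j \<omega> * D i \<omega>) (if j = i then exp \<delta> ^ j * ?\<rho> else 0)"
      unfolding D_def
      using martingale_difference_second_moments[OF \<open>\<delta> > 0\<close> indep X, of j i] that False by simp
    then show ?thesis using False by (simp add: mult.commute)
  qed
  have Xm: "X i \<in> borel_measurable M" if "i < n" for i
    using distributed_measurable[OF X[OF that]] by simp
  have sq: "(\<Sum>i<n. c i * D i \<omega>)\<^sup>2 = (\<Sum>i<n. \<Sum>j<n. c i * c j * (D i \<omega> * D j \<omega>))" for \<omega>
    by (simp add: power2_eq_square sum_product mult_ac)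
  have "has_bochner_integral M (\<lambda>\<omega>. (\<Sum>i<n. c i * D i \<omega>)\<^sup>2)
      (\<Sum>i<n. \<Sum>j<n. c i * c j * (if i = j then exp \<delta> ^ i * ?\<rho> else 0))"
    unfolding sq by (intro has_bochner_integral_sum has_bochner_integral_mult_right DD) auto
  moreover have "(\<Sum>i<n. \<Sum>j<n. c i * c j * (if i = j then exp \<delta> ^ i * ?\<rho> else 0))
      = (\<Sum>i<n. (c i)\<^sup>2 * (exp \<delta> ^ i * ?\<rho>))"
    by (intro sum.cong) (simp_all add: if_distrib[of "\<lambda>x. _ * x"] sum.delta power2_eq_square cong: if_cong)
  ultimately have S: "has_bochner_integral M (\<lambda>\<omega>. (\<Sum>i<n. c i * D i \<omega>)\<^sup>2) (\<Sum>i<n. (c i)\<^sup>2 * (exp \<delta> ^ i * ?\<rho>))"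
    by simp
  have bound: "(\<Sum>i<n. (c i)\<^sup>2 * (exp \<delta> ^ i * ?\<rho>)) \<le> real n * (B\<^sup>2 * (exp (real n * \<delta>) * ?\<rho>))"
  proof -
    have "(c i)\<^sup>2 * (exp \<delta> ^ i * ?\<rho>) \<le> B\<^sup>2 * (exp (real n * \<delta>) * ?\<rho>)" if "i < n" for i
    proof (intro mult_mono)
      show "(c i)\<^sup>2 \<le> B\<^sup>2" using c[OF that] by (simp add: abs_le_square_iff[symmetric])
      show "exp \<delta> ^ i \<le> exp (real n * \<delta>)"
        using that \<open>\<delta> > 0\<close> by (simp add: exp_of_nat_mult[symmetric])
    qed (use \<rho> in auto)
    then show ?thesis
      using sum_bounded_above[of "{..<n}" "\<lambda>i. (c i)\<^sup>2 * (exp \<delta> ^ i * ?\<rho>)"] by simp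
  qed
  have Dm: "D i \<in> borel_measurable M" if "i < n" for i
    unfolding D_def using that Xm
    by (intro borel_measurable_times borel_measurable_prod measurable_compose[OF _ measurable_exp_increment]
        measurable_compose[OF _ measurable_exp_remainder]) auto
  have "prob {\<omega>\<in>space M. \<bar>\<Sum>i<n. c i * D i \<omega>\<bar> > e} \<le> prob {\<omega>\<in>space M. (\<Sum>i<n. c i * D i \<omega>)\<^sup>2 \<ge> e\<^sup>2}"
  proof (rule finite_measure_mono)
    show "{\<omega>\<in>space M. (\<Sum>i<n. c i * D i \<omega>)\<^sup>2 \<ge> e\<^sup>2} \<in> events"
      using borel_measurable_integrable[OF integrable.intros[OF S]] by measurable
    show "{\<omega>\<in>space M. \<bar>\<Sum>i<n. c i * D i \<omega>\<bar> > e} \<subseteq> {\<omega>\<in>space M. (\<Sum>i<n. c i * D i \<omega>)\<^sup>2 \<ge> e\<^sup>2}"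
      using \<open>e > 0\<close> by (auto simp: abs_le_square_iff[symmetric])
  qed
  also have "\<dots> \<le> expectation (\<lambda>\<omega>. (\<Sum>i<n. c i * D i \<omega>)\<^sup>2) / e\<^sup>2"
    using S \<open>e > 0\<close> by (intro integral_Markov_inequality_measure[where A = "{}"]) (auto simp: has_bochner_integral_iff)
  also have "\<dots> \<le> real n * (B\<^sup>2 * (exp (real n * \<delta>) * ?\<rho>)) / e\<^sup>2"
    using bound S by (intro divide_right_mono) (auto simp: has_bochner_integral_iff)
  finally show ?thesis .
qed

section \<open>Geometric Brownian motion as an integrator\<close>

locale brownian_interval = prob_space M for M :: "'w measure" +
  fixes a b :: real and W :: "real \<Rightarrow> 'w \<Rightarrow> real"
  assumes a_less_b: "a < b" and brownian: "standard_brownian_motion M a b W"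
begin

text \<open>The process G of the overview. Only increments from \<open>a\<close> enter, so it is
  adapted to the increment filtration whatever \<open>W a\<close> is;
  \<open>exp (W t \<omega> - t / 2)\<close> need not be.\<close>

definition gbm :: "real \<Rightarrow> 'w \<Rightarrow> real" where
  "gbm t \<omega> = exp (W t \<omega> - W a \<omega> - (t - a) / 2)"

lemma W_measurable: "t \<in> {a..b} \<Longrightarrow> W t \<in> borel_measurable M"
  using brownian by (auto simp: standard_brownian_motion_def)

lemma W_continuous: "\<omega> \<in> space M \<Longrightarrow> continuous_on {a..b} (\<lambda>t. W t \<omega>)"
  using brownian by (auto simp: standard_brownian_motion_def)

lemma gbm_pos: "gbm t \<omega> > 0"
  by (simp add: gbm_def)

lemma gbm_start [simp]: "gbm a \<omega> = 1"
  by (simp add: gbm_def)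

lemma gbm_continuous: "\<omega> \<in> space M \<Longrightarrow> continuous_on {a..b} (\<lambda>t. gbm t \<omega>)"
  unfolding gbm_def by (intro continuous_intros W_continuous) auto

lemma gbm_measurable: "t \<in> {a..b} \<Longrightarrow> gbm t \<in> borel_measurable M"
  unfolding gbm_def using W_measurable[of t] W_measurable[of a] a_less_b by measurable

lemma gbm_adapted:
  assumes "a \<le> t"
  shows "gbm t \<in> borel_measurable (increment_filtration M a W t)"
proof -
  have gen: "{(\<lambda>\<omega>. W s \<omega> - W a \<omega>) -` B \<inter> space M | s B. s \<in> {a..t} \<and> B \<in> sets borel} \<subseteq> Pow (space M)"
    by auto
  have "(\<lambda>\<omega>. W t \<omega> - W a \<omega>) \<in> borel_measurable (increment_filtration M a W t)"
    using assms gen by (intro measurableI) (auto simp: increment_filtration_def space_measure_of sets_measure_of intro!: sigma_sets.Basic)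
  then show ?thesis unfolding gbm_def by measurable
qed

text \<open>Telescoping in the exponent. The factors belong to different cells, which is what makes
  independence of the increments applicable.\<close>

lemma gbm_grid:
  assumes "i \<le> Suc k"
  shows "gbm (grid a b k i) \<omega> = (\<Prod>l<i. exp_increment ((b - a) / real (Suc k))
           (W (grid a b k (Suc l)) \<omega> - W (grid a b k l) \<omega>))"
proof (induction i)
  case (Suc i)
  have "gbm (grid a b k (Suc i)) \<omega> = gbm (grid a b k i) \<omega> * exp_increment ((b - a) / real (Suc k))
           (W (grid a b k (Suc i)) \<omega> - W (grid a b k i) \<omega>)"
    unfolding gbm_def exp_increment_def exp_add[symmetric] grid_Suc_diff[of a b k i, symmetric]
    by (simp add: field_simps)
  then show ?case using Suc by simp
qed simp

definition euler_error :: "nat \<Rightarrow> nat \<Rightarrow> 'w \<Rightarrow> real" where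
  "euler_error k i \<omega> = gbm (grid a b k (Suc i)) \<omega> - gbm (grid a b k i) \<omega>
     - gbm (grid a b k i) \<omega> * (W (grid a b k (Suc i)) \<omega> - W (grid a b k i) \<omega>)"

text \<open>The value of \<open>gbm\<close> at the left end factors out, leaving a mean-zero
  function of the current increment: a martingale difference.\<close>

lemma euler_error_eq:
  assumes "i < Suc k"
  shows "euler_error k i \<omega> = (\<Prod>l<i. exp_increment ((b - a) / real (Suc k))
           (W (grid a b k (Suc l)) \<omega> - W (grid a b k l) \<omega>))
         * exp_remainder ((b - a) / real (Suc k)) (W (grid a b k (Suc i)) \<omega> - W (grid a b k i) \<omega>)"
  using assms unfolding euler_error_def gbm_grid[OF Suc_leI[OF assms]] gbm_grid[OF less_imp_le[OF assms]]
  by (simp add: exp_remainder_def algebra_simps)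

lemma euler_error_sum_tendsto_0:
  assumes h: "\<And>t. t \<in> {a..b} \<Longrightarrow> \<bar>h t\<bar> \<le> B" and "e > 0"
  shows "(\<lambda>k. prob {\<omega>\<in>space M. \<bar>\<Sum>i<Suc k. h (grid a b k i) * euler_error k i \<omega>\<bar> > e}) \<longlonglongrightarrow> 0"
proof (rule tendsto_sandwich[OF _ _ tendsto_const])
  let ?\<delta> = "\<lambda>k. (b - a) / real (Suc k)"
  \<comment> \<open>With n cells and n \<delta> = b - a, the bound n B^2 exp(b - a) \<delta>^2 / e^2
    is this constant divided by n.\<close>
  let ?C = "B\<^sup>2 * exp (b - a) * (b - a)\<^sup>2 / e\<^sup>2"
  have \<delta>0: "?\<delta> \<longlonglongrightarrow> 0"
    using LIMSEQ_inverse_real_of_nat[THEN tendsto_mult_left, of "b - a"] by (simp add: divide_inverse)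
  \<comment> \<open>The estimate \<open>exp \<delta> \<le> 1 + \<delta> + \<delta>\<^sup>2\<close>
    is used for steps between 0 and 1.\<close>
  then have "\<forall>\<^sub>F k in sequentially. ?\<delta> k < 1" by (rule order_tendstoD) simp
  then show "\<forall>\<^sub>F k in sequentially. prob {\<omega>\<in>space M.
      \<bar>\<Sum>i<Suc k. h (grid a b k i) * euler_error k i \<omega>\<bar> > e} \<le> ?C * inverse (real (Suc k))"
  proof eventually_elim
    case (elim k)
    define n where "n = Suc k"
    define \<delta> where "\<delta> = ?\<delta> k"
    define X where "X l \<omega> = W (grid a b k (Suc l)) \<omega> - W (grid a b k l) \<omega>" for l \<omega>
    have \<delta>: "\<delta> > 0" "\<delta> < 1" "real n * \<delta> = b - a"
      using elim a_less_b by (auto simp: \<delta>_def n_def)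
    have "prob {\<omega>\<in>space M. \<bar>\<Sum>i<n. h (grid a b k i) *
          ((\<Prod>l<i. exp_increment \<delta> (X l \<omega>)) * exp_remainder \<delta> (X i \<omega>))\<bar> > e}
        \<le> real n * (B\<^sup>2 * (exp (real n * \<delta>) * (exp \<delta> - 1 - \<delta>))) / e\<^sup>2"
    proof (rule martingale_difference_sum_prob_le[OF \<delta>(1) _ _ _ \<open>e > 0\<close>])
      have "\<forall>i\<le>n. grid a b k i \<in> {a..b}" "\<forall>i<n. grid a b k i \<le> grid a b k (Suc i)"
        using a_less_b by (auto simp: n_def intro!: grid_mono grid_in_interval simp del: atLeastAtMost_iff)
      then show "indep_vars (\<lambda>_. borel) X {..<n}"
        using brownian unfolding standard_brownian_motion_def X_def by blast
      show "distributed M lborel (X i) (normal_density 0 (sqrt \<delta>))" if "i < n" for i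
      proof -
        have "grid a b k i \<in> {a..b}" "grid a b k (Suc i) \<in> {a..b}"
          using that a_less_b by (auto simp: n_def intro!: grid_in_interval simp del: atLeastAtMost_iff)
        moreover have "grid a b k (Suc i) - grid a b k i = \<delta>"
          by (simp add: grid_Suc_diff \<delta>_def)
        ultimately show ?thesis
          using brownian \<delta>(1) unfolding standard_brownian_motion_def X_def by force
      qed
      show "\<bar>h (grid a b k i)\<bar> \<le> B" if "i < n" for i
        using that a_less_b by (intro h grid_in_interval) (auto simp: n_def)
    qed
    also have "\<dots> \<le> real n * (B\<^sup>2 * (exp (real n * \<delta>) * \<delta>\<^sup>2)) / e\<^sup>2"
      using exp_bound[of \<delta>] \<delta> by (intro divide_right_mono mult_left_mono) auto
    also have "\<dots> = ?C * inverse (real n)"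
    proof -
      have "real n * \<delta>\<^sup>2 = (real n * \<delta>)\<^sup>2 * inverse (real n)"
        by (simp add: n_def power2_eq_square field_simps)
      then show ?thesis unfolding \<delta>(3) by (simp add: divide_inverse mult_ac)
    qed
    also have "{\<omega>\<in>space M. \<bar>\<Sum>i<n. h (grid a b k i) *
          ((\<Prod>l<i. exp_increment \<delta> (X l \<omega>)) * exp_remainder \<delta> (X i \<omega>))\<bar> > e}
        = {\<omega>\<in>space M. \<bar>\<Sum>i<Suc k. h (grid a b k i) * euler_error k i \<omega>\<bar> > e}"
      unfolding n_def \<delta>_def X_def by (simp add: euler_error_eq del: sum.lessThan_Suc prod.lessThan_Suc cong: sum.cong_simp)
    finally show ?case by (simp add: n_def)
  qed
  show "(\<lambda>k. ?C * inverse (real (Suc k))) \<longlonglongrightarrow> 0"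
    using LIMSEQ_inverse_real_of_nat[THEN tendsto_mult_left, of ?C] by simp
qed simp

section \<open>The integration by parts formula\<close>

lemma H1_cont: "h \<in> H1 a b \<Longrightarrow> continuous_on {a..b} h"
  by (auto simp: H1_def intro: abs_continuous_on_imp_continuous_on)

lemma gbm_times_jointly_measurable:
  assumes "g \<in> borel_measurable (restrict_space lborel {a..b})"
  shows "(\<lambda>(t, \<omega>). gbm t \<omega> * g t) \<in> borel_measurable (restrict_space lborel {a..b} \<Otimes>\<^sub>M M)"
proof -
  have "(\<lambda>(t, \<omega>). gbm t \<omega>) \<in> borel_measurable (restrict_space lborel {a..b} \<Otimes>\<^sub>M M)"
    by (intro continuous_process_jointly_measurable a_less_b gbm_measurable gbm_continuous)
  then show ?thesis
    using borel_measurable_times[OF _ measurable_compose[OF measurable_fst assms], of "\<lambda>x. gbm (fst x) (snd x)" M]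
    by (simp add: split_beta)
qed

lemma set_integrable_gbm_deriv:
  assumes "h \<in> H1 a b" "\<omega> \<in> space M"
  shows "set_integrable lborel {a..b} (\<lambda>t. gbm t \<omega> * deriv h t)"
proof -
  obtain C where C: "\<And>t. t \<in> {a..b} \<Longrightarrow> \<bar>gbm t \<omega>\<bar> \<le> C"
    using compact_imp_bounded[OF compact_continuous_image[OF gbm_continuous[OF assms(2)] compact_Icc]]
    by (fastforce simp: bounded_iff)
  have h': "set_integrable lborel {a..b} (deriv h)"
    using assms(1) by (auto simp: H1_def intro: set_integrable_L2_on)
  show ?thesis
  proof (rule set_integrable_bound)
    show "set_integrable lborel {a..b} (\<lambda>t. C * deriv h t)" using h' by simp
    have "(\<lambda>t. indicator {a..b} t *\<^sub>R gbm t \<omega>) \<in> borel_measurable lborel"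
      using borel_measurable_continuous_on_indicator[OF _ gbm_continuous[OF assms(2)]] by simp
    moreover have "(\<lambda>t. indicator {a..b} t *\<^sub>R deriv h t) \<in> borel_measurable lborel"
      using h' by (auto simp: set_integrable_def)
    ultimately have "(\<lambda>t. (indicator {a..b} t *\<^sub>R gbm t \<omega>) * (indicator {a..b} t *\<^sub>R deriv h t)) \<in> borel_measurable lborel"
      by measurable
    also have "(\<lambda>t. (indicator {a..b} t *\<^sub>R gbm t \<omega>) * (indicator {a..b} t *\<^sub>R deriv h t))
        = (\<lambda>t. indicator {a..b} t *\<^sub>R (gbm t \<omega> * deriv h t))"
      by (auto simp: indicator_def)
    finally show "set_borel_measurable lborel {a..b} (\<lambda>t. gbm t \<omega> * deriv h t)"
      by (simp add: set_borel_measurable_def)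
    have "\<bar>gbm t \<omega> * deriv h t\<bar> \<le> \<bar>C * deriv h t\<bar>" if "t \<in> {a..b}" for t
    proof -
      have "\<bar>gbm t \<omega>\<bar> \<le> \<bar>C\<bar>" using C[OF that] by simp
      then show ?thesis unfolding abs_mult by (intro mult_right_mono) auto
    qed
    then show "AE t\<in>{a..b} in lborel. norm (gbm t \<omega> * deriv h t) \<le> norm (C * deriv h t)"
      by auto
  qed
qed

text \<open>By \<open>H1_increment\<close> on each cell, the sum is exactly the integral of
  \<open>deriv h\<close> against the right-endpoint step function of the path. The error is
  therefore at most the uniform distance of that step function from the path times the L1 norm of
  \<open>deriv h\<close>.\<close>

lemma gbm_stieltjes_tendsto:
  assumes h: "h \<in> H1 a b" and \<omega>: "\<omega> \<in> space M" and "e > 0"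
  shows "\<forall>\<^sub>F k in sequentially. \<bar>(LINT t:{a..b}|lborel. gbm t \<omega> * deriv h t)
     - (\<Sum>i<Suc k. (h (grid a b k (Suc i)) - h (grid a b k i)) * gbm (grid a b k (Suc i)) \<omega>)\<bar> < e"
proof -
  have h': "set_integrable lborel {a..b} (deriv h)"
    using h by (auto simp: H1_def intro: set_integrable_L2_on)
  define V where "V = (LINT t:{a..b}|lborel. \<bar>deriv h t\<bar>)"
  have "V \<ge> 0" unfolding V_def set_lebesgue_integral_def by (intro Bochner_Integration.integral_nonneg) auto
  \<comment> \<open>Chosen so that \<open>e' * V < e\<close>; the added 1 covers the case
    \<open>V = 0\<close>.\<close>
  define e' where "e' = e / (V + 1)"
  have e': "e' > 0" using \<open>V \<ge> 0\<close> \<open>e > 0\<close> by (simp add: e'_def add_nonneg_pos)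
  from simple_process_grid_uniform[OF a_less_b gbm_continuous[OF \<omega>] e', of \<omega>]
  show ?thesis
  proof eventually_elim
    case (elim k)
    let ?g = "grid a b k"
    define sp where "sp t = simple_process (Suc k) ?g (\<lambda>i _. gbm (?g (Suc i)) \<omega>) t \<omega>" for t
    have sp: "\<bar>sp t - gbm t \<omega>\<bar> < e'" if "t \<in> {a<..b}" for t
      using elim[rule_format, OF that, of "\<lambda>i. ?g (Suc i)"] a_less_b by (simp add: sp_def grid_mono)
    have cell: "set_integrable lborel {?g i<..?g (Suc i)} (deriv h)" if "i < Suc k" for i
      using h' grid_in_interval[of a b i k] grid_in_interval[of a b "Suc i" k] that a_less_b
      by (auto intro!: set_integrable_subset[OF h'])
    have sph: "indicator {a..b} t * (sp t * deriv h t)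
        = (\<Sum>i<Suc k. gbm (?g (Suc i)) \<omega> * (indicator {?g i<..?g (Suc i)} t * deriv h t))" for t
    proof -
      have "indicator {a..b} t * indicator {?g i<..?g (Suc i)} t = (indicator {?g i<..?g (Suc i)} t :: real)"
        if "i < Suc k" for i
        using grid_in_interval[of a b i k] grid_in_interval[of a b "Suc i" k] that a_less_b
        by (auto simp: indicator_def)
      then show ?thesis
        unfolding sp_def simple_process_def sum_distrib_left sum_distrib_right
        by (intro sum.cong refl) (simp add: mult_ac)
    qed
    have "has_bochner_integral lborel (\<lambda>t. indicator {a..b} t * (sp t * deriv h t))
       (\<Sum>i<Suc k. gbm (?g (Suc i)) \<omega> * (h (?g (Suc i)) - h (?g i)))"
      unfolding sph
    proof (intro has_bochner_integral_sum has_bochner_integral_mult_right)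
      fix i assume "i \<in> {..<Suc k}"
      then have i: "i < Suc k" by simp
      show "has_bochner_integral lborel (\<lambda>t. indicator {?g i<..?g (Suc i)} t * deriv h t) (h (?g (Suc i)) - h (?g i))"
        using cell[OF i] H1_increment[OF h, of "?g i" "?g (Suc i)"] a_less_b i
          grid_in_interval[of a b i k] grid_in_interval[of a b "Suc i" k] grid_mono[of a b i "Suc i" k]
        by (simp add: has_bochner_integral_iff set_integrable_def)
    qed
    then have I: "integrable lborel (\<lambda>t. indicator {a..b} t * (sp t * deriv h t))"
      "(\<integral>t. indicator {a..b} t * (sp t * deriv h t) \<partial>lborel)
        = (\<Sum>i<Suc k. (h (?g (Suc i)) - h (?g i)) * gbm (?g (Suc i)) \<omega>)"
      by (simp_all add: has_bochner_integral_iff mult.commute)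
    have G: "integrable lborel (\<lambda>t. indicator {a..b} t * (gbm t \<omega> * deriv h t))"
      using set_integrable_gbm_deriv[OF h \<omega>] by (simp add: set_integrable_def)
    have A: "integrable lborel (\<lambda>t. e' * (indicator {a..b} t * \<bar>deriv h t\<bar>))"
      using set_integrable_abs[OF h'] by (simp add: set_integrable_def)
    have "\<bar>(LINT t:{a..b}|lborel. gbm t \<omega> * deriv h t)
        - (\<Sum>i<Suc k. (h (?g (Suc i)) - h (?g i)) * gbm (?g (Suc i)) \<omega>)\<bar>
      = norm (\<integral>t. indicator {a..b} t * (gbm t \<omega> * deriv h t) - indicator {a..b} t * (sp t * deriv h t) \<partial>lborel)"
      using Bochner_Integration.integral_diff[OF G I(1)] I(2) by (simp add: set_lebesgue_integral_def)
    also have "\<dots> \<le> (\<integral>t. e' * (indicator {a..b} t * \<bar>deriv h t\<bar>) \<partial>lborel)"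
    proof (rule order_trans[OF integral_norm_bound integral_mono_AE])
      show "integrable lborel (\<lambda>t. norm (indicator {a..b} t * (gbm t \<omega> * deriv h t) - indicator {a..b} t * (sp t * deriv h t)))"
        using G I(1) by (intro integrable_norm Bochner_Integration.integrable_diff)
      have "norm (indicator {a..b} t * (gbm t \<omega> * deriv h t) - indicator {a..b} t * (sp t * deriv h t))
        \<le> e' * (indicator {a..b} t * \<bar>deriv h t\<bar>)" if "t \<noteq> a" for t
      proof (cases "t \<in> {a<..b}")
        case True
        have "\<bar>gbm t \<omega> * deriv h t - sp t * deriv h t\<bar> = \<bar>sp t - gbm t \<omega>\<bar> * \<bar>deriv h t\<bar>"
          by (simp add: abs_mult[symmetric] abs_minus_commute left_diff_distrib)
        also have "\<dots> \<le> e' * \<bar>deriv h t\<bar>" using sp[OF True] by (intro mult_right_mono) auto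
        finally show ?thesis using True by simp
      qed (use that in auto)
      then show "AE t in lborel. norm (indicator {a..b} t * (gbm t \<omega> * deriv h t) - indicator {a..b} t * (sp t * deriv h t))
        \<le> e' * (indicator {a..b} t * \<bar>deriv h t\<bar>)"
        using AE_lborel_singleton[of a] by (auto elim: eventually_mono)
    qed (rule A)
    also have "\<dots> = e' * V" by (simp add: V_def set_lebesgue_integral_def)
    also have "\<dots> < e" using \<open>V \<ge> 0\<close> \<open>e > 0\<close> by (simp add: e'_def field_simps)
    finally show ?case .
  qed
qed

lemma simple_adapted_gbm:
  "simple_adapted M a b W (Suc k) (grid a b k) (\<lambda>i \<omega>. gbm (grid a b k i) \<omega> * h (grid a b k i))"
  unfolding simple_adapted_def using a_less_b
  using grid_mono[of a b 0 _ k] by (auto intro!: grid_mono borel_measurable_times gbm_adapted)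

text \<open>The discrete product rule, with G taken at the right end next to the increments of
  \<open>h\<close> and \<open>h\<close> at the left end next to those of G, leaves no product of two
  increments. The boundary terms telescope to zero because \<open>h\<close> vanishes at both
  ends.\<close>

lemma simple_integral_gbm:
  assumes "h a = 0" "h b = 0"
  shows "simple_integral W (Suc k) (grid a b k) (\<lambda>i \<omega>. gbm (grid a b k i) \<omega> * h (grid a b k i)) \<omega>
    = - (\<Sum>i<Suc k. (h (grid a b k (Suc i)) - h (grid a b k i)) * gbm (grid a b k (Suc i)) \<omega>)
      - (\<Sum>i<Suc k. h (grid a b k i) * euler_error k i \<omega>)"
proof -
  let ?g = "grid a b k"
  have "(\<Sum>i<Suc k. h (?g (Suc i)) * gbm (?g (Suc i)) \<omega> - h (?g i) * gbm (?g i) \<omega>) = 0"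
    using sum_lessThan_telescope[of "\<lambda>i. h (?g i) * gbm (?g i) \<omega>" "Suc k"] assms
    by (simp del: sum.lessThan_Suc)
  moreover have "gbm (?g i) \<omega> * h (?g i) * (W (?g (Suc i)) \<omega> - W (?g i) \<omega>)
      = (h (?g (Suc i)) * gbm (?g (Suc i)) \<omega> - h (?g i) * gbm (?g i) \<omega>)
      - (h (?g (Suc i)) - h (?g i)) * gbm (?g (Suc i)) \<omega> - h (?g i) * euler_error k i \<omega>" for i
    by (simp add: euler_error_def algebra_simps)
  ultimately show ?thesis
    unfolding simple_integral_def by (simp add: sum_subtractf del: sum.lessThan_Suc)
qed

lemma has_ito_integral_gbm:
  assumes h: "h \<in> H1 a b"
  shows "has_ito_integral M a b W (\<lambda>t \<omega>. gbm t \<omega> * h t)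
    (\<lambda>\<omega>. - (LINT t:{a..b}|lborel. gbm t \<omega> * deriv h t))"
proof -
  have ends: "h a = 0" "h b = 0" and h'_L2: "L2_on a b (deriv h)"
    using h by (auto simp: H1_def)
  define I where "I \<omega> = - (LINT t:{a..b}|lborel. gbm t \<omega> * deriv h t)" for \<omega>
  define \<xi> where "\<xi> k i \<omega> = gbm (grid a b k i) \<omega> * h (grid a b k i)" for k i \<omega>
  have gridI: "grid a b k i \<in> {a..b}" if "i \<le> Suc k" for k i
    using that a_less_b by (intro grid_in_interval) auto
  have Ycont: "continuous_on {a..b} (\<lambda>t. gbm t \<omega> * h t)" if "\<omega> \<in> space M" for \<omega>
    by (intro continuous_intros gbm_continuous that H1_cont h)
  have Yjoint: "(\<lambda>(t, \<omega>). gbm t \<omega> * h t) \<in> borel_measurable (restrict_space lborel {a..b} \<Otimes>\<^sub>M M)"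
    by (intro continuous_process_jointly_measurable a_less_b Ycont borel_measurable_times gbm_measurable) auto
  have "(\<lambda>(t, \<omega>). gbm t \<omega> * deriv h t) \<in> borel_measurable (restrict_space lborel {a..b} \<Otimes>\<^sub>M M)"
    using h'_L2 by (intro gbm_times_jointly_measurable)
      (auto simp: L2_on_def set_borel_measurable_def borel_measurable_restrict_space_iff)
  then have Imeas: "I \<in> borel_measurable M"
    unfolding I_def by (intro borel_measurable_uminus borel_measurable_set_integral_parameter)
  have L2: "(\<integral>\<^sup>+ t\<in>{a..b}. ennreal ((gbm t \<omega> * h t)\<^sup>2) \<partial>lborel) < \<infinity>" if \<omega>: "\<omega> \<in> space M" for \<omega>
  proof -
    obtain C where C: "\<And>t. t \<in> {a..b} \<Longrightarrow> \<bar>gbm t \<omega> * h t\<bar> \<le> C"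
      using compact_imp_bounded[OF compact_continuous_image[OF Ycont[OF \<omega>] compact_Icc]]
      by (fastforce simp: bounded_iff)
    have "(\<integral>\<^sup>+ t\<in>{a..b}. ennreal ((gbm t \<omega> * h t)\<^sup>2) \<partial>lborel) \<le> (\<integral>\<^sup>+ t\<in>{a..b}. ennreal (C\<^sup>2) \<partial>lborel)"
      using power_mono[OF C, of _ 2] by (intro nn_integral_mono) (auto simp: indicator_def intro!: ennreal_leI)
    also have "\<dots> < \<infinity>" using a_less_b by (simp add: nn_integral_cmult_indicator ennreal_mult_less_top)
    finally show ?thesis .
  qed
  have approx: "(\<lambda>k. prob {\<omega>\<in>space M.
      (\<integral>\<^sup>+ t\<in>{a..b}. ennreal ((simple_process (Suc k) (grid a b k) (\<xi> k) t \<omega> - gbm t \<omega> * h t)\<^sup>2) \<partial>lborel)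
        > ennreal e}) \<longlonglongrightarrow> 0" if "e > 0" for e
  proof (rule prob_tendsto_0_if_eventually_notin)
    fix k
    have "(\<lambda>(t, \<omega>). simple_process (Suc k) (grid a b k) (\<xi> k) t \<omega>)
        \<in> borel_measurable (restrict_space lborel {a..b} \<Otimes>\<^sub>M M)"
      unfolding \<xi>_def by (intro borel_measurable_simple_process borel_measurable_times gbm_measurable gridI) auto
    from borel_measurable_diff[OF this Yjoint]
    have "(\<lambda>(t, \<omega>). ennreal ((simple_process (Suc k) (grid a b k) (\<xi> k) t \<omega> - gbm t \<omega> * h t)\<^sup>2))
        \<in> borel_measurable (restrict_space lborel {a..b} \<Otimes>\<^sub>M M)"
      unfolding split_beta by measurable
    from borel_measurable_set_nn_integral_parameter[OF this]
    show "{\<omega>\<in>space M. (\<integral>\<^sup>+ t\<in>{a..b}. ennreal ((simple_process (Suc k) (grid a b k) (\<xi> k) t \<omega> - gbm t \<omega> * h t)\<^sup>2) \<partial>lborel)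
        > ennreal e} \<in> events"
      by measurable
  next
    fix \<omega> assume \<omega>: "\<omega> \<in> space M"
    \<comment> \<open>A uniform error below \<open>r\<close> gives a squared L2 error of at most
      \<open>r\<^sup>2 * (b - a) = e\<close>.\<close>
    define r where "r = sqrt (e / (b - a))"
    have r: "r > 0" "r\<^sup>2 * (b - a) = e" using \<open>e > 0\<close> a_less_b by (auto simp: r_def)
    from simple_process_grid_uniform[OF a_less_b Ycont[OF \<omega>] r(1), of \<omega>]
    show "\<forall>\<^sub>F k in sequentially. \<omega> \<notin> {\<omega>\<in>space M.
      (\<integral>\<^sup>+ t\<in>{a..b}. ennreal ((simple_process (Suc k) (grid a b k) (\<xi> k) t \<omega> - gbm t \<omega> * h t)\<^sup>2) \<partial>lborel)
        > ennreal e}"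
    proof eventually_elim
      case (elim k)
      have close: "\<bar>simple_process (Suc k) (grid a b k) (\<xi> k) t \<omega> - gbm t \<omega> * h t\<bar> < r" if "t \<in> {a<..b}" for t
        using elim[rule_format, OF that, of "grid a b k"] a_less_b
        by (simp add: simple_process_def \<xi>_def grid_mono)
      have "(\<integral>\<^sup>+ t\<in>{a..b}. ennreal ((simple_process (Suc k) (grid a b k) (\<xi> k) t \<omega> - gbm t \<omega> * h t)\<^sup>2) \<partial>lborel)
        \<le> (\<integral>\<^sup>+ t\<in>{a..b}. ennreal (r\<^sup>2) \<partial>lborel)"
      proof (rule nn_integral_mono_AE)
        have *: "(simple_process (Suc k) (grid a b k) (\<xi> k) t \<omega> - gbm t \<omega> * h t)\<^sup>2 \<le> r\<^sup>2" if "t \<in> {a<..b}" for t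
          using close[OF that] r(1) by (simp add: abs_le_square_iff[symmetric])
        show "AE t in lborel. ennreal ((simple_process (Suc k) (grid a b k) (\<xi> k) t \<omega> - gbm t \<omega> * h t)\<^sup>2) * indicator {a..b} t
            \<le> ennreal (r\<^sup>2) * indicator {a..b} t"
          using AE_lborel_singleton[of a]
          by eventually_elim (use * in \<open>auto simp: indicator_def intro!: ennreal_leI\<close>)
      qed
      also have "\<dots> = ennreal (r\<^sup>2 * (b - a))"
        using a_less_b by (simp add: nn_integral_cmult_indicator ennreal_mult)
      finally show ?case unfolding r(2) by (simp add: not_less)
    qed
  qed
  have conv: "(\<lambda>k. prob {\<omega>\<in>space M.
      \<bar>simple_integral W (Suc k) (grid a b k) (\<xi> k) \<omega> - I \<omega>\<bar> > e}) \<longlonglongrightarrow> 0" if "e > 0" for e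
  proof -
    define S where "S k \<omega> = (\<Sum>i<Suc k. (h (grid a b k (Suc i)) - h (grid a b k i)) * gbm (grid a b k (Suc i)) \<omega>)" for k \<omega>
    define E where "E k \<omega> = (\<Sum>i<Suc k. h (grid a b k i) * euler_error k i \<omega>)" for k \<omega>
    have Sm: "S k \<in> borel_measurable M" for k
      unfolding S_def by (intro borel_measurable_sum borel_measurable_times gbm_measurable gridI) auto
    have Em: "E k \<in> borel_measurable M" for k
      unfolding E_def euler_error_def
      by (intro borel_measurable_sum borel_measurable_times borel_measurable_diff gbm_measurable W_measurable gridI) auto
    obtain B where B: "\<And>t. t \<in> {a..b} \<Longrightarrow> \<bar>h t\<bar> \<le> B"
      using compact_imp_bounded[OF compact_continuous_image[OF H1_cont[OF h] compact_Icc]]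
      by (fastforce simp: bounded_iff)
    \<comment> \<open>The simple integral minus \<open>I\<close> is
      \<open>(- S k \<omega> - I \<omega>) - E k \<omega>\<close>, so exceeding \<open>e\<close>
      forces one part to exceed \<open>e / 2\<close>. The first part is handled path by path, the
      second through second moments.\<close>
    let ?P = "\<lambda>k. {\<omega>\<in>space M. \<bar>- S k \<omega> - I \<omega>\<bar> > e / 2}" and ?Q = "\<lambda>k. {\<omega>\<in>space M. \<bar>E k \<omega>\<bar> > e / 2}"
    have PQ: "?P k \<in> events" "?Q k \<in> events" for k
      using Sm[of k] Em[of k] Imeas by measurable
    have "(\<lambda>k. prob (?P k)) \<longlonglongrightarrow> 0"
    proof (rule prob_tendsto_0_if_eventually_notin[OF PQ(1)])
      fix \<omega> assume \<omega>: "\<omega> \<in> space M"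
      from gbm_stieltjes_tendsto[OF h \<omega> half_gt_zero[OF \<open>e > 0\<close>]]
      show "\<forall>\<^sub>F k in sequentially. \<omega> \<notin> ?P k"
        by eventually_elim (simp add: S_def I_def not_less abs_minus_commute del: sum.lessThan_Suc)
    qed
    moreover have "(\<lambda>k. prob (?Q k)) \<longlonglongrightarrow> 0"
      unfolding E_def using \<open>e > 0\<close> by (intro euler_error_sum_tendsto_0[OF B]) auto
    ultimately have "(\<lambda>k. prob (?P k) + prob (?Q k)) \<longlonglongrightarrow> 0"
      using tendsto_add[of _ 0 sequentially _ 0] by simp
    then show ?thesis
    proof (rule tendsto_sandwich[OF _ _ tendsto_const, rotated 2])
      have "prob {\<omega>\<in>space M. \<bar>simple_integral W (Suc k) (grid a b k) (\<xi> k) \<omega> - I \<omega>\<bar> > e}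
          \<le> prob (?P k \<union> ?Q k)" for k
      proof (rule finite_measure_mono)
        have "simple_integral W (Suc k) (grid a b k) (\<xi> k) \<omega> = - S k \<omega> - E k \<omega>" for \<omega>
          using simple_integral_gbm[OF ends, of k \<omega>] by (simp add: S_def E_def \<xi>_def[abs_def])
        then show "{\<omega>\<in>space M. \<bar>simple_integral W (Suc k) (grid a b k) (\<xi> k) \<omega> - I \<omega>\<bar> > e} \<subseteq> ?P k \<union> ?Q k"
          by (force simp: abs_if split: if_splits)
      qed (use PQ in auto)
      also have "prob (?P k \<union> ?Q k) \<le> prob (?P k) + prob (?Q k)" for k
        using PQ by (intro measure_subadditive) auto
      finally show "\<forall>\<^sub>F k in sequentially. prob {\<omega>\<in>space M. \<bar>simple_integral W (Suc k) (grid a b k) (\<xi> k) \<omega> - I \<omega>\<bar> > e}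
          \<le> prob (?P k) + prob (?Q k)"
        by (rule always_eventually[OF allI])
    qed simp
  qed
  show ?thesis
    unfolding has_ito_integral_def I_def[symmetric]
  proof (intro conjI ballI)
    show "(\<lambda>\<omega>. gbm t \<omega> * h t) \<in> borel_measurable (increment_filtration M a W t)" if "t \<in> {a..b}" for t
      using that by (intro borel_measurable_times gbm_adapted) auto
    show "\<exists>n \<tau> \<xi>. (\<forall>k. simple_adapted M a b W (n k) (\<tau> k) (\<xi> k)) \<and>
        (\<forall>e>0. (\<lambda>k::nat. prob {\<omega>\<in>space M.
            (\<integral>\<^sup>+ t\<in>{a..b}. ennreal ((simple_process (n k) (\<tau> k) (\<xi> k) t \<omega> - gbm t \<omega> * h t)\<^sup>2) \<partial>lborel)
              > ennreal e}) \<longlonglongrightarrow> 0) \<and>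
        (\<forall>e>0. (\<lambda>k::nat. prob {\<omega>\<in>space M.
            \<bar>simple_integral W (n k) (\<tau> k) (\<xi> k) \<omega> - I \<omega>\<bar> > e}) \<longlonglongrightarrow> 0)"
      by (rule exI[of _ Suc], rule exI[of _ "grid a b"], rule exI[of _ \<xi>])
        (use approx conv simple_adapted_gbm in \<open>simp add: \<xi>_def[abs_def]\<close>)
  qed (use Yjoint Imeas L2 in auto)
qed

section \<open>Integrals of geometric Brownian motion\<close>

definition gbm_int :: "real \<Rightarrow> 'w \<Rightarrow> real" where
  "gbm_int t \<omega> = (LINT s:{a..t}|lborel. gbm s \<omega>)"

lemma set_integrable_gbm:
  assumes "\<omega> \<in> space M" "a \<le> x" "y \<le> b"
  shows "set_integrable lborel {x..y} (\<lambda>t. gbm t \<omega>)"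
  by (rule borel_integrable_atLeastAtMost'[OF continuous_on_subset[OF gbm_continuous[OF assms(1)]]])
    (use assms in auto)

lemma gbm_int_start [simp]: "gbm_int a \<omega> = 0"
  unfolding gbm_int_def set_lebesgue_integral_def
  using AE_lborel_singleton[of a] by (intro integral_eq_zero_AE) (auto elim: eventually_mono)

lemma gbm_int_has_derivative:
  assumes "\<omega> \<in> space M" "t \<in> {a..b}"
  shows "((\<lambda>t. gbm_int t \<omega>) has_real_derivative gbm t \<omega>) (at t within {a..b})"
proof -
  have "gbm_int s \<omega> = integral {a..s} (\<lambda>t. gbm t \<omega>)" if "s \<in> {a..b}" for s
    unfolding gbm_int_def
    by (rule set_borel_integral_eq_integral(2)[OF set_integrable_gbm[OF assms(1)]]) (use that in auto)
  then show ?thesis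
    by (intro has_field_derivative_transform_within[OF
        integral_has_real_derivative[OF gbm_continuous[OF assms(1)] assms(2)] zero_less_one assms(2)]) simp
qed

text \<open>The upper limit is moved into the integrand as an indicator, so that the parameter
  integral over the fixed interval \<open>{a..b}\<close> applies.\<close>

lemma gbm_int_measurable:
  assumes "t \<in> {a..b}"
  shows "gbm_int t \<in> borel_measurable M"
proof -
  have "(\<lambda>(s, \<omega>). gbm s \<omega> * indicator {a..t} s) \<in> borel_measurable (restrict_space lborel {a..b} \<Otimes>\<^sub>M M)"
    by (intro gbm_times_jointly_measurable measurable_restrict_space1) auto
  from borel_measurable_set_integral_parameter[OF this]
  show ?thesis
    using assms unfolding gbm_int_def[abs_def] set_lebesgue_integral_def
    by (elim measurable_cong[THEN iffD1, rotated]) (auto intro!: Bochner_Integration.integral_cong simp: indicator_def)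
qed

text \<open>This is the common denominator of \<open>u\<close> and \<open>v\<close> up to a positive
  factor; were it zero, division would return 0 and the boundary value 1 would fail.\<close>

lemma gbm_int_end_pos:
  assumes "\<omega> \<in> space M"
  shows "gbm_int b \<omega> > 0"
proof -
  have "gbm_int a \<omega> < gbm_int b \<omega>"
  proof (rule DERIV_pos_imp_increasing_open[OF a_less_b])
    show "\<exists>y. ((\<lambda>t. gbm_int t \<omega>) has_real_derivative y) (at t) \<and> 0 < y" if "a < t" "t < b" for t
      using gbm_int_has_derivative[OF assms, of t] that gbm_pos[of t \<omega>]
        at_within_interior[of t "{a..b}"] by (auto simp: interior_atLeastAtMost_real)
    show "continuous_on {a..b} (\<lambda>t. gbm_int t \<omega>)"
      using gbm_int_has_derivative[OF assms] by (rule DERIV_continuous_on)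
  qed
  then show ?thesis by simp
qed

text \<open>The common shape of \<open>u\<close> and \<open>v\<close>. Differentiation in time
  removes \<open>d\<close> and leaves \<open>c\<close> times \<open>gbm\<close>, so the non-adapted
  \<open>c\<close> is a random factor in front of an adapted integrand.\<close>

lemma is_solution_affine_gbm_int:
  assumes c: "c \<in> borel_measurable M" and d: "d \<in> borel_measurable M"
    and f: "\<And>t \<omega>. t \<in> {a..b} \<Longrightarrow> \<omega> \<in> space M \<Longrightarrow> f t \<omega> = c \<omega> * gbm_int t \<omega> + d \<omega>"
  shows "is_solution M a b W f"
  unfolding is_solution_def
proof (intro conjI ballI)
  show "f t \<in> borel_measurable M" if "t \<in> {a..b}" for t
  proof -
    have "(\<lambda>\<omega>. c \<omega> * gbm_int t \<omega> + d \<omega>) \<in> borel_measurable M"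
      using gbm_int_measurable[OF that] c d by measurable
    then show ?thesis using f[OF that] by (simp cong: measurable_cong)
  qed
  have f_deriv: "((\<lambda>t. f t \<omega>) has_real_derivative c \<omega> * gbm t \<omega>) (at t within {a..b})"
    if "t \<in> {a..b}" "\<omega> \<in> space M" for t \<omega>
  proof -
    have "((\<lambda>t. c \<omega> * gbm_int t \<omega> + d \<omega>) has_real_derivative c \<omega> * gbm t \<omega>) (at t within {a..b})"
      by (auto intro!: derivative_eq_intros gbm_int_has_derivative that)
    then show ?thesis
      by (rule has_field_derivative_transform_within[OF _ zero_less_one that(1)]) (simp add: f that)
  qed
  have deriv_f: "deriv (\<lambda>t. f t \<omega>) t = c \<omega> * gbm t \<omega>" if "a < t" "t < b" "\<omega> \<in> space M" for t \<omega>
    using f_deriv[of t \<omega>] that at_within_interior[of t "{a..b}"]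
    by (auto simp: interior_atLeastAtMost_real intro: DERIV_imp_deriv)
  show "AE \<omega> in M. abs_continuous_on a b (\<lambda>t. f t \<omega>)"
  proof (rule AE_I2)
    fix \<omega> assume \<omega>: "\<omega> \<in> space M"
    have "continuous_on {a..b} (\<lambda>t. c \<omega> * gbm t \<omega>)"
      by (intro continuous_intros gbm_continuous \<omega>)
    from compact_imp_bounded[OF compact_continuous_image[OF this compact_Icc]]
    obtain B where B: "\<And>t. t \<in> {a..b} \<Longrightarrow> \<bar>c \<omega> * gbm t \<omega>\<bar> \<le> B"
      by (fastforce simp: bounded_iff)
    show "abs_continuous_on a b (\<lambda>t. f t \<omega>)"
    proof (rule lipschitz_imp_abs_continuous_on)
      show "\<bar>f y \<omega> - f x \<omega>\<bar> \<le> B * (y - x)" if "a \<le> x" "x \<le> y" "y \<le> b" for x y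
        using field_differentiable_bound[of "{a..b}" "\<lambda>t. f t \<omega>" "\<lambda>t. c \<omega> * gbm t \<omega>" B y x] f_deriv[OF _ \<omega>] B that
        by simp
    qed
  qed
  fix h assume h: "h \<in> H1 a b"
  let ?I = "\<lambda>\<omega>. - (LINT t:{a..b}|lborel. gbm t \<omega> * deriv h t)"
  have form: "set_integrable lborel {a..b} (\<lambda>t. deriv (\<lambda>s. f s \<omega>) t * deriv h t / 2)"
    "(LINT t:{a..b}|lborel. deriv (\<lambda>s. f s \<omega>) t * deriv h t / 2)
      = c \<omega> / 2 * (LINT t:{a..b}|lborel. gbm t \<omega> * deriv h t)" if \<omega>: "\<omega> \<in> space M" for \<omega>
  proof -
    let ?F = "\<lambda>t. deriv (\<lambda>s. f s \<omega>) t * deriv h t / 2" and ?G = "\<lambda>t. c \<omega> / 2 * (gbm t \<omega> * deriv h t)"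
    have G: "set_integrable lborel {a..b} ?G"
      using set_integrable_gbm_deriv[OF h \<omega>] by simp
    \<comment> \<open>At \<open>a\<close> and \<open>b\<close> the two-sided derivative of \<open>f\<close> is arbitrary; correcting these two points keeps
      the integrand Borel measurable.\<close>
    have FG: "indicator {a..b} t *\<^sub>R ?F t = indicator {a..b} t *\<^sub>R ?G t
        + (?F a - ?G a) * indicator {a} t + (?F b - ?G b) * indicator {b} t" for t
      using deriv_f[OF _ _ \<omega>, of t] a_less_b
      by (cases "t = a \<or> t = b") (auto simp: indicator_def)
    have fin: "has_bochner_integral lborel (\<lambda>t. r * indicator {s} t) 0" for r s :: real
      by (simp add: has_bochner_integral_iff)
    have "has_bochner_integral lborel (\<lambda>t. indicator {a..b} t *\<^sub>R ?F t)
        ((LINT t:{a..b}|lborel. ?G t) + 0 + 0)"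
      unfolding FG set_lebesgue_integral_def
      by (rule has_bochner_integral_add[OF has_bochner_integral_add[OF
            has_bochner_integral_integrable[OF G[unfolded set_integrable_def]] fin] fin])
    then have "set_integrable lborel {a..b} ?F \<and> (LINT t:{a..b}|lborel. ?F t) = (LINT t:{a..b}|lborel. ?G t)"
      by (simp add: has_bochner_integral_iff set_integrable_def set_lebesgue_integral_def)
    then show "set_integrable lborel {a..b} ?F"
      "(LINT t:{a..b}|lborel. ?F t) = c \<omega> / 2 * (LINT t:{a..b}|lborel. gbm t \<omega> * deriv h t)"
      by (simp_all only: set_integral_mult_right)
  qed
  \<comment> \<open>The random factor is \<open>c / 2\<close>, taken out of the Ito integral of
    \<open>gbm\<close> times \<open>h\<close>.\<close>
  have "has_dW_integral M a b W (\<lambda>t \<omega>. deriv (\<lambda>s. f s \<omega>) t * h t / 2) (\<lambda>\<omega>. c \<omega> / 2 * ?I \<omega>)"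
    unfolding has_dW_integral_def
  proof (intro exI conjI)
    show "(\<lambda>\<omega>. c \<omega> / 2) \<in> borel_measurable M" using c by measurable
    show "has_ito_integral M a b W (\<lambda>t \<omega>. gbm t \<omega> * h t) ?I" by (rule has_ito_integral_gbm[OF h])
    show "AE \<omega> in M. AE t in lborel. t \<in> {a..b} \<longrightarrow>
        deriv (\<lambda>s. f s \<omega>) t * h t / 2 = c \<omega> / 2 * (gbm t \<omega> * h t)"
    proof (rule AE_I2)
      fix \<omega> assume \<omega>: "\<omega> \<in> space M"
      show "AE t in lborel. t \<in> {a..b} \<longrightarrow> deriv (\<lambda>s. f s \<omega>) t * h t / 2 = c \<omega> / 2 * (gbm t \<omega> * h t)"
        using AE_lborel_singleton[of a] AE_lborel_singleton[of b]
        by eventually_elim (use deriv_f[OF _ _ \<omega>] in auto)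
    qed
  qed simp
  \<comment> \<open>With K the integral of \<open>gbm\<close> times \<open>deriv h\<close>, the form
    is -(c/2) K - (c/2)(-K) = 0.\<close>
  then have "has_form_value M a b W f h (\<lambda>_. 0)"
    unfolding has_form_value_def using form
    by (intro conjI exI[of _ "\<lambda>\<omega>. c \<omega> / 2 * ?I \<omega>"] AE_I2) auto
  then show "\<exists>X. has_form_value M a b W f h X \<and> (AE \<omega> in M. X \<omega> = 0)"
    by (intro exI[of _ "\<lambda>_. 0"]) simp
qed

lemma exp_W_set_integral:
  "(LINT s:A|lborel. exp (W s \<omega> - s / 2)) = exp (W a \<omega> - a / 2) * (LINT s:A|lborel. gbm s \<omega>)"
proof -
  have "(\<lambda>s. exp (W s \<omega> - s / 2)) = (\<lambda>s. exp (W a \<omega> - a / 2) * gbm s \<omega>)"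
  proof
    fix s
    have "W s \<omega> - s / 2 = (W a \<omega> - a / 2) + (W s \<omega> - W a \<omega> - (s - a) / 2)"
      by (simp add: field_simps)
    then show "exp (W s \<omega> - s / 2) = exp (W a \<omega> - a / 2) * gbm s \<omega>"
      unfolding gbm_def by (simp only: exp_add)
  qed
  then show ?thesis by (simp only: set_integral_mult_right)
qed

text \<open>Brings the numerator of \<open>v\<close> to the affine shape already treated.\<close>

lemma gbm_int_reversed:
  assumes "t \<in> {a..b}" "\<omega> \<in> space M"
  shows "(LINT s:{t..b}|lborel. gbm s \<omega>) = gbm_int b \<omega> - gbm_int t \<omega>"
proof -
  have "((\<lambda>s. gbm s \<omega>) has_integral gbm_int b \<omega> - gbm_int t \<omega>) {t..b}"
  proof (rule fundamental_theorem_of_calculus)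
    show "((\<lambda>t. gbm_int t \<omega>) has_vector_derivative gbm x \<omega>) (at x within {t..b})" if "x \<in> {t..b}" for x
      using gbm_int_has_derivative[OF assms(2), of x] that assms(1)
      by (auto simp: has_real_derivative_iff_has_vector_derivative[symmetric] intro: DERIV_subset)
  qed (use assms in auto)
  then show ?thesis
    using set_borel_integral_eq_integral(2)[OF set_integrable_gbm[OF assms(2)], of t b] assms(1)
    by (simp add: integral_unique)
qed

end

theorem theorem10:
  fixes M :: "'w measure" and W u v :: "real \<Rightarrow> 'w \<Rightarrow> real" and a b :: real
  assumes "a < b"
    and "standard_brownian_motion M a b W"
    and "u = (\<lambda>t \<omega>. (LINT s:{a..t}|lborel. exp (W s \<omega> - s / 2)) /
                     (LINT s:{a..b}|lborel. exp (W s \<omega> - s / 2)))"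
    and "v = (\<lambda>t \<omega>. (LINT s:{t..b}|lborel. exp (W s \<omega> - s / 2)) /
                     (LINT s:{a..b}|lborel. exp (W s \<omega> - s / 2)))"
  shows "is_solution M a b W u \<and>
         is_solution M a b W v \<and>
         linearly_independent_processes M a b u v \<and>
         (\<forall>\<omega>\<in>space M. u a \<omega> = 0 \<and> u b \<omega> = 1 \<and> v a \<omega> = 1 \<and> v b \<omega> = 0)"
proof -
  interpret prob_space M using assms(2) by (simp add: standard_brownian_motion_def)
  interpret brownian_interval M a b W by unfold_locales (fact assms)+
  have u: "u t \<omega> = 1 / gbm_int b \<omega> * gbm_int t \<omega> + 0" for t \<omega>
    unfolding assms(3) exp_W_set_integral gbm_int_def by simp
  \<comment> \<open>The summand 1 is \<open>gbm_int b \<omega> / gbm_int b \<omega>\<close>, which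
    is where positivity enters.\<close>
  have v: "v t \<omega> = - 1 / gbm_int b \<omega> * gbm_int t \<omega> + 1" if "t \<in> {a..b}" "\<omega> \<in> space M" for t \<omega>
    unfolding assms(4) exp_W_set_integral gbm_int_reversed[OF that] gbm_int_def[symmetric]
    using gbm_int_end_pos[OF that(2)] by (simp add: diff_divide_distrib)
  have [measurable]: "gbm_int b \<in> borel_measurable M"
    using assms(1) by (intro gbm_int_measurable) auto
  have "is_solution M a b W u"
    by (rule is_solution_affine_gbm_int[where c = "\<lambda>\<omega>. 1 / gbm_int b \<omega>" and d = "\<lambda>_. 0"]) (measurable, rule u)
  moreover have "is_solution M a b W v"
    by (rule is_solution_affine_gbm_int[where c = "\<lambda>\<omega>. - 1 / gbm_int b \<omega>" and d = "\<lambda>_. 1"]) (measurable, rule v)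
  moreover have ends: "\<forall>\<omega>\<in>space M. u a \<omega> = 0 \<and> u b \<omega> = 1 \<and> v a \<omega> = 1 \<and> v b \<omega> = 0"
    using assms(1) gbm_int_end_pos by (auto simp: u v less_imp_neq[symmetric])
  moreover have "linearly_independent_processes M a b u v"
    unfolding linearly_independent_processes_def
  proof (intro ballI impI conjI)
    fix C D assume CD: "\<forall>t\<in>{a..b}. AE \<omega> in M. C \<omega> * u t \<omega> + D \<omega> * v t \<omega> = 0"
    \<comment> \<open>The boundary values isolate the coefficients: at \<open>b\<close> only
      \<open>C\<close> survives, at \<open>a\<close> only \<open>D\<close>.\<close>
    from CD assms(1) have "AE \<omega> in M. C \<omega> * u b \<omega> + D \<omega> * v b \<omega> = 0" by simp
    then show "AE \<omega> in M. C \<omega> = 0" using AE_space by eventually_elim (use ends in simp)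
    from CD assms(1) have "AE \<omega> in M. C \<omega> * u a \<omega> + D \<omega> * v a \<omega> = 0" by simp
    then show "AE \<omega> in M. D \<omega> = 0" using AE_space by eventually_elim (use ends in simp)
  qed
  ultimately show ?thesis by blast
qed

end
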